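(* Let $\Omega\subseteq\mathbb{R}^N$ be a region with $C^2$ boundary and let $r>0$ be such that $B(p\pm rn(p);r)\cap\partial\Omega=\emptyset$ for all $p\in\partial\Omega$, where $n(p)$ is the unit normal to $\partial\Omega$ at $p$. Let $m\ge1$ be an integer and let $K=K_{m,N}$ be the constant, depending only on $m$ and $N$, defined in the context. Then for all $\beta>0$ with $\beta\ge 4K/r$, $$\left(1-\sqrt{\frac{K}{\beta r}}\right)d_g(x,y)\le d_{m,\beta}(x,y)\le d_g(x,y)\qquad\text{for all }x,y\in\Omega.$$
   Context: A region is a non-empty connected open set. $B(z;r)$ is the open ball with centre $z$ and radius $r$. $C^2$ boundary: $\partial\Omega=\partial\overline\Omega$, and for each $p\in\partial\Omega$ there are an open set $U\ni p$ in $\mathbb{R}^N$, a local (Euclidean) coordinate system $(\mathbf{y},y_N)$, $\mathbf{y}=(y_1,\dots,y_{N-1})$, with origin at $p$, a convex open set $G\subseteq\mathbb{R}^{N-1}$ and a function $h\in C^2(\overline G)$ such that $\partial\Omega\cap U=\{y_N=h(\mathbf{y}),\ \mathbf{y}\in G\}$. The unit normal $n(p)$ points out of $\Omega$. Riemannian distance: $d_g(x,y):=\inf\{l(\gamma):\gamma(0)=x,\ \gamma(1)=y,\ \gamma\subseteq\overline\Omega,\ \gamma\text{ continuous and piecewise }C^1\}$, where $l(\gamma)$ is the length of $\gamma$. Riemannian-type metrics: for $\beta>0$, $\mathcal{E}_{m,\beta}$ is the set of all bounded real-valued smooth functions $\phi$ on $\Omega$ with $\|\nabla\phi\|_\infty\le1$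 and $\|D^i\phi\|_\infty\le\beta^{|i|-1}$ for all multi-indices $i$ with $2\le|i|\le m$, and $d_{m,\beta}(x,y)=\sup\{\phi(y)-\phi(x):\phi\in\mathcal{E}_{m,\beta}\}$. The constant $K$: for a smooth non-negative function $k$ on $\mathbb{R}^N$, supported in the unit ball $B(0;1)$ and with $\int k=1$, put $$K_{m,N,k}:=\sup_{1\le|j|\le m-1}\left(\int_{B(0;1)}|D^jk|\right)^{1/|j|}$$ (supremum over multi-indices $j$; the empty supremum, for $m=1$, is $0$). Then $K=K_{m,N}$ is the infimum of $K_{m,N,k}$ over all such $k$. *)

theory Defs
  imports "HOL-Analysis.Analysis"
begin

text \<open>
  $\mathbb{R}^N$ is rendered as \<open>real ^ 'n\<close> with \<open>N = CARD('n)\<close>; multi-indices are functions \<open>'n \<Rightarrow> nat\<close>.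
\<close>

definition region :: "'a::topological_space set \<Rightarrow> bool" where
  "region S \<longleftrightarrow> S \<noteq> {} \<and> connected S \<and> open S"


section \<open>Partial derivatives and smoothness\<close>

text \<open>
  The partial derivative is taken along the coordinate line through the point, so that it also
  makes sense for functions of which only the values on a coordinate hyperplane matter.
\<close>

definition pderiv_dir :: "'n::finite \<Rightarrow> (real ^ 'n \<Rightarrow> real) \<Rightarrow> real ^ 'n \<Rightarrow> real" where
  "pderiv_dir a f x = deriv (\<lambda>t. f (x + t *\<^sub>R axis a 1)) 0"

definition grad :: "(real ^ 'n::finite \<Rightarrow> real) \<Rightarrow> real ^ 'n \<Rightarrow> real ^ 'n" where
  "grad f x = (\<chi> a. pderiv_dir a f x)"

definition mi_order :: "('n::finite \<Rightarrow> nat) \<Rightarrow> nat" where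
  "mi_order i = (\<Sum>a\<in>UNIV. i a)"

text \<open>
  \<open>mderiv i f\<close> is $D^i f$. The order in which the coordinates are processed is immaterial, since
  \<open>mderiv\<close> is only applied to functions of class $C^{|i|}$.
\<close>

definition coord_list :: "'n::finite list" where
  "coord_list = (SOME as. distinct as \<and> set as = UNIV)"

definition mderiv :: "('n::finite \<Rightarrow> nat) \<Rightarrow> (real ^ 'n \<Rightarrow> real) \<Rightarrow> real ^ 'n \<Rightarrow> real" where
  "mderiv i f = foldr (\<lambda>a. pderiv_dir a ^^ i a) coord_list f"

text \<open>
  \<open>Ck_on k A S f\<close>: \<open>f\<close> is of class $C^k$ on \<open>S\<close>, where \<open>S\<close> is relatively open in a translate of
  the coordinate subspace spanned by the directions in \<open>A\<close>. With \<open>A = UNIV\<close> this is the usual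
  notion on open subsets of $\mathbb{R}^N$; with \<open>A = UNIV - {e}\<close> it is the usual notion on open
  subsets of $\mathbb{R}^{N-1}$, identified with the hyperplane \<open>{v. v $ e = 0}\<close>.
\<close>

primrec Ck_on :: "nat \<Rightarrow> 'n::finite set \<Rightarrow> (real ^ 'n) set \<Rightarrow> (real ^ 'n \<Rightarrow> real) \<Rightarrow> bool" where
  "Ck_on 0 A S f \<longleftrightarrow> continuous_on S f"
| "Ck_on (Suc k) A S f \<longleftrightarrow> f differentiable_on S \<and> (\<forall>a\<in>A. Ck_on k A S (pderiv_dir a f))"

definition smooth_on :: "(real ^ 'n::finite) set \<Rightarrow> (real ^ 'n \<Rightarrow> real) \<Rightarrow> bool" where
  "smooth_on S f \<longleftrightarrow> (\<forall>k. Ck_on k UNIV S f)"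

text \<open>
  $C^k(\overline S)$: functions in $C^k(S)$ all of whose derivatives of order at most \<open>k\<close> extend
  continuously to the closure.
\<close>

definition Ck_closure :: "nat \<Rightarrow> 'n::finite set \<Rightarrow> (real ^ 'n) set \<Rightarrow> (real ^ 'n \<Rightarrow> real) \<Rightarrow> bool" where
  "Ck_closure k A S f \<longleftrightarrow>
     continuous_on (closure S) f \<and> Ck_on k A S f \<and>
     (\<forall>i. mi_order i \<le> k \<and> (\<forall>a. a \<notin> A \<longrightarrow> i a = 0) \<longrightarrow>
        (\<exists>g. continuous_on (closure S) g \<and> (\<forall>y\<in>S. g y = mderiv i f y)))"


section \<open>Domains with \<open>C\<^sup>2\<close> boundary\<close>

text \<open>
  The local Euclidean coordinate system with origin \<open>p\<close> is \<open>y \<mapsto> p + T y\<close> with \<open>T\<close> orthogonal;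
  \<open>e\<close> is the index of the distinguished coordinate $y_N$, and $\mathbb{R}^{N-1}$ is the hyperplane
  \<open>{y. y $ e = 0}\<close>, so that the point with coordinates $(\mathbf{y}, h(\mathbf{y}))$ is
  \<open>p + T (y + h y *\<^sub>R axis e 1)\<close>.
\<close>

definition C2_boundary :: "(real ^ 'n::finite) set \<Rightarrow> bool" where
  "C2_boundary \<Omega> \<longleftrightarrow>
     frontier \<Omega> = frontier (closure \<Omega>) \<and>
     (\<forall>p\<in>frontier \<Omega>. \<exists>U (T :: real ^ 'n \<Rightarrow> real ^ 'n) (e :: 'n) G h.
        open U \<and> p \<in> U \<and> orthogonal_transformation T \<and>
        openin (top_of_set {y. y $ e = 0}) G \<and> convex G \<and> Ck_closure 2 (UNIV - {e}) G h \<and>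
        frontier \<Omega> \<inter> U = (\<lambda>y. p + T (y + h y *\<^sub>R axis e 1)) ` G)"

definition tangent_vector :: "'a::real_normed_vector set \<Rightarrow> 'a \<Rightarrow> 'a \<Rightarrow> bool" where
  "tangent_vector M p v \<longleftrightarrow>
     (\<exists>\<gamma>. (\<forall>t::real. \<gamma> t \<in> M) \<and> \<gamma> 0 = p \<and> (\<gamma> has_vector_derivative v) (at 0))"

text \<open>For a set with \<open>C\<^sup>2\<close> boundary, each boundary point has exactly one such vector.\<close>

definition outward_unit_normal :: "'a::real_inner set \<Rightarrow> 'a \<Rightarrow> 'a \<Rightarrow> bool" where
  "outward_unit_normal \<Omega> p \<nu> \<longleftrightarrow>
     norm \<nu> = 1 \<and> (\<forall>v. tangent_vector (frontier \<Omega>) p v \<longrightarrow> \<nu> \<bullet> v = 0) \<and>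
     (\<exists>\<epsilon>>0. \<forall>t. 0 < t \<and> t < \<epsilon> \<longrightarrow> p - t *\<^sub>R \<nu> \<in> \<Omega> \<and> p + t *\<^sub>R \<nu> \<notin> closure \<Omega>)"


section \<open>The two metrics\<close>

definition curve_length :: "(real \<Rightarrow> 'a::real_normed_vector) \<Rightarrow> real" where
  "curve_length \<gamma> = integral {0..1} (\<lambda>t. norm (vector_derivative \<gamma> (at t)))"

text \<open>
  A \<open>valid_path\<close> is continuous and \<open>C\<^sup>1\<close> off finitely many parameters, near which its speed may
  be unbounded; the integrability condition only discards curves of infinite length, for which
  \<open>curve_length\<close> would be the dummy value \<open>0\<close>.
\<close>

definition riem_dist :: "(real ^ 'n::finite) set \<Rightarrow> real ^ 'n \<Rightarrow> real ^ 'n \<Rightarrow> real" where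
  "riem_dist \<Omega> x y =
     Inf {curve_length \<gamma> | \<gamma>.
            valid_path \<gamma> \<and> pathstart \<gamma> = x \<and> pathfinish \<gamma> = y \<and>
            path_image \<gamma> \<subseteq> closure \<Omega> \<and>
            (\<lambda>t. norm (vector_derivative \<gamma> (at t))) integrable_on {0..1}}"

definition test_functions :: "(real ^ 'n::finite) set \<Rightarrow> nat \<Rightarrow> real \<Rightarrow> (real ^ 'n \<Rightarrow> real) set" where
  "test_functions \<Omega> m \<beta> =
     {\<phi>. bounded (\<phi> ` \<Omega>) \<and> smooth_on \<Omega> \<phi> \<and>
         (\<forall>x\<in>\<Omega>. norm (grad \<phi> x) \<le> 1) \<and>
         (\<forall>i. 2 \<le> mi_order i \<and> mi_order i \<le> m \<longrightarrow>
            (\<forall>x\<in>\<Omega>. \<bar>mderiv i \<phi> x\<bar> \<le> \<beta> ^ (mi_order i - 1)))}"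

definition metric_d :: "(real ^ 'n::finite) set \<Rightarrow> nat \<Rightarrow> real \<Rightarrow> real ^ 'n \<Rightarrow> real ^ 'n \<Rightarrow> real" where
  "metric_d \<Omega> m \<beta> x y = Sup {\<phi> y - \<phi> x | \<phi>. \<phi> \<in> test_functions \<Omega> m \<beta>}"


section \<open>The constant \<open>K\<close>\<close>

definition mollifier :: "(real ^ 'n::finite \<Rightarrow> real) \<Rightarrow> bool" where
  "mollifier k \<longleftrightarrow>
     smooth_on UNIV k \<and> (\<forall>x. 0 \<le> k x) \<and> closure {x. k x \<noteq> 0} \<subseteq> ball 0 1 \<and>
     integral\<^sup>L lborel k = 1"

text \<open>
  Inserting \<open>0\<close> does not change the supremum of a non-empty family of non-negative numbers and
  makes the empty supremum (\<open>m = 1\<close>) equal to \<open>0\<close>.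
\<close>

definition mollifier_K :: "nat \<Rightarrow> (real ^ 'n::finite \<Rightarrow> real) \<Rightarrow> real" where
  "mollifier_K m k =
     Sup (insert 0 {(LINT x:ball 0 1|lborel. \<bar>mderiv j k x\<bar>) powr (1 / real (mi_order j)) | j.
                      1 \<le> mi_order j \<and> mi_order j \<le> m - 1})"

definition const_K :: "'n::finite itself \<Rightarrow> nat \<Rightarrow> real" where
  "const_K _ m = Inf {mollifier_K m k | k :: real ^ 'n \<Rightarrow> real. mollifier k}"

end

theory Submission
  imports Defs "HOL-Real_Asymp.Real_Asymp"
begin

text \<open>
  The geometry enters through the ball condition: at every frontier point \<open>p\<close> of \<open>\<Omega>\<close> a ball of
  radius \<open>r\<close> contained in \<open>\<Omega>\<close> touches a ball of radius \<open>r\<close> missing \<open>closure \<Omega>\<close>, with centres on the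
  normal line. The exterior ball gives the estimate \<open>n p \<bullet> (q - p) \<le> |q - p|\<^sup>2 / 2r\<close> for \<open>q\<close> in
  \<open>closure \<Omega>\<close>, so \<open>closure \<Omega>\<close> has reach at least \<open>r\<close>: its nearest-point map is Lipschitz with
  constant \<open>r / (r - h)\<close> on the tube of width \<open>h < r\<close> (\<open>proj_lipschitz\<close>). Cutting a segment of this
  tube finely, projecting the division points and moving them slightly inwards yields a polygon,
  inside \<open>\<Omega>\<close> up to its end points, of length almost \<open>r / (r - h)\<close> times that of the segment (\<open>projected_segment_chain\<close>).
  A segment of length \<open>s < 2r\<close> between points of \<open>closure \<Omega>\<close> stays within
  \<open>r - sqrt (r\<^sup>2 - s\<^sup>2/4)\<close> of \<open>closure \<Omega>\<close>, so at small distances the intrinsic and the Euclidean distance have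
  ratio close to \<open>1\<close> (\<open>nearby_chain\<close>).

  Upper bound. A test function has slope at most \<open>1\<close> along segments in \<open>\<Omega>\<close>, but a curve may touch the
  boundary. Replacing finely spaced points of the curve by points of \<open>\<Omega>\<close> and joining these by
  short polygons in \<open>\<Omega>\<close> costs an arbitrarily small factor (\<open>chain_lipschitz_le_curve\<close>).

  Lower bound. Fix a mollifier whose constant is at most \<open>K' > K\<close>, and let \<open>\<epsilon> = K'/\<beta>\<close>. If \<open>f\<close> is
  \<open>L\<close>-Lipschitz on the \<open>\<epsilon>\<close>-ball about each point of \<open>\<Omega>\<close>, then its mollification at scale \<open>\<epsilon>\<close>, divided by
  \<open>L\<close>, is a test function: of a derivative of order \<open>k\<close> all but one differentiation fall on the
  mollifier, which costs a factor \<open>(K'/\<epsilon>)^(k-1) = \<beta>^(k-1)\<close>, and the last is controlled by the Lipschitz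
  constant (\<open>mollify_test_function\<close>). This is applied to two functions. The
  intrinsic distance from \<open>x\<close>, composed with the nearest-point map, has \<open>L = r / (r - \<epsilon>)\<close>, which gives
  the lower bound \<open>(1 - \<epsilon>/r) D - 2\<epsilon>\<close>, where \<open>D\<close> is the distance of \<open>x\<close> and \<open>y\<close>
  (\<open>smoothed_distance_lower_bound\<close>); it is good for distant points. A truncated linear function
  gives \<open>|x - y|\<close> (\<open>linear_test_function\<close>), which is good for close points.
  With \<open>t = sqrt (\<epsilon>/r)\<close>, one of the two is at least \<open>(1 - t) D\<close> (\<open>combine_lower_bounds\<close>). Finally
  \<open>K'\<close> tends to \<open>K\<close>; this needs some room beyond \<open>t \<le> 1/2\<close>, and \<open>t \<le> 3/5\<close> is
  what the elementary inequality offers.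
\<close>

section \<open>Polygonal chains\<close>

text \<open>
  Polygons with vertices added at the end, where \<open>l\<close> is any upper bound of the length. The slack makes
  the relation monotone in \<open>l\<close>, so that lengths need only be estimated.
\<close>

inductive polygonal_chain :: "'a::real_normed_vector set \<Rightarrow> 'a \<Rightarrow> 'a \<Rightarrow> real \<Rightarrow> bool"
  for S x where
  trivial_chain: "x \<in> S \<Longrightarrow> 0 \<le> l \<Longrightarrow> polygonal_chain S x x l"
| extend_chain: "polygonal_chain S x y l \<Longrightarrow> closed_segment y z \<subseteq> S \<Longrightarrow> l + dist y z \<le> l' \<Longrightarrow>
         polygonal_chain S x z l'"

lemma polygonal_chain_nonneg: "polygonal_chain S x y l \<Longrightarrow> 0 \<le> l"
proof (induction rule: polygonal_chain.induct)
  case (extend_chain y l z l')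
  then show ?case using zero_le_dist[of y z] by linarith
qed

lemma polygonal_chain_mono:
  assumes "polygonal_chain S x y l" "l \<le> l'"
  shows "polygonal_chain S x y l'"
  using assms(1)
proof cases
  case trivial_chain
  then show ?thesis using assms(2) by (auto intro: polygonal_chain.trivial_chain)
next
  case (extend_chain y l)
  then show ?thesis using assms(2) by (auto intro: polygonal_chain.extend_chain)
qed

lemma polygonal_chain_trans:
  assumes "polygonal_chain S y z l'" "polygonal_chain S x y l"
  shows "polygonal_chain S x z (l + l')"
  using assms
proof (induction)
  case (trivial_chain l')
  then show ?case by (auto intro: polygonal_chain_mono)
next
  case (extend_chain u k z l')
  then show ?case by (auto intro: polygonal_chain.extend_chain)
qed

lemma polygonal_chain_segment:
  assumes "closed_segment x y \<subseteq> S" "dist x y \<le> l"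
  shows "polygonal_chain S x y l"
  using assms by (auto intro!: polygonal_chain.extend_chain[OF polygonal_chain.trivial_chain[of x S 0]])

lemma polygonal_chain_sym:
  assumes "polygonal_chain S x y l"
  shows "polygonal_chain S y x l"
  using assms
proof (induction)
  case (trivial_chain l)
  then show ?case by (rule polygonal_chain.trivial_chain)
next
  case (extend_chain y l z l')
  have "polygonal_chain S z y (dist y z)"
    using extend_chain(2) by (intro polygonal_chain_segment) (auto simp: closed_segment_commute dist_commute)
  from polygonal_chain_trans[OF extend_chain.IH this] show ?case
    by (rule polygonal_chain_mono) (use extend_chain(3) in simp)
qed

definition chain_dist :: "'a::real_normed_vector set \<Rightarrow> 'a \<Rightarrow> 'a \<Rightarrow> real" where
  "chain_dist S x y = Inf {l. polygonal_chain S x y l}"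

lemma chain_dist_le: "polygonal_chain S x y l \<Longrightarrow> chain_dist S x y \<le> l"
  unfolding chain_dist_def
  by (rule cInf_lower) (auto intro!: bdd_belowI[of _ 0] dest: polygonal_chain_nonneg)

lemma chain_dist_extend:
  assumes "polygonal_chain S x p l0" "polygonal_chain S p q l"
  shows "chain_dist S x q \<le> chain_dist S x p + l"
proof -
  have "chain_dist S x q - l \<le> Inf {l. polygonal_chain S x p l}"
  proof (rule cInf_greatest)
    fix l' assume "l' \<in> {l. polygonal_chain S x p l}"
    then have "polygonal_chain S x q (l' + l)" using polygonal_chain_trans[OF assms(2)] by simp
    then show "chain_dist S x q - l \<le> l'" using chain_dist_le by fastforce
  qed (use assms in auto)
  then show ?thesis by (simp add: chain_dist_def)
qed

lemma chain_dist_nonneg: "polygonal_chain S x y l \<Longrightarrow> 0 \<le> chain_dist S x y"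
  unfolding chain_dist_def by (rule cInf_greatest) (auto dest: polygonal_chain_nonneg)

lemma chain_dist_self:
  assumes "x \<in> S"
  shows "chain_dist S x x = 0"
proof -
  have "polygonal_chain S x x 0" using assms by (rule trivial_chain) simp
  then show ?thesis using chain_dist_le chain_dist_nonneg by (metis antisym)
qed

section \<open>Balls, segments and nearest points\<close>

text \<open>
  Otherwise the point dividing the segment between the centres in the ratio of the radii lies in both balls.
\<close>

lemma disjoint_balls_dist_ge:
  fixes a b :: "'a::euclidean_space"
  assumes "ball a s \<inter> ball b t = {}" "0 < s" "0 < t"
  shows "s + t \<le> dist a b"
proof (rule ccontr)
  assume *: "\<not> s + t \<le> dist a b"
  define z where "z = a + (s / (s + t)) *\<^sub>R (b - a)"
  have "dist a z = s / (s + t) * dist a b"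
    using assms by (simp add: z_def dist_norm norm_minus_commute)
  moreover have "z - b = (t / (s + t)) *\<^sub>R (a - b)"
  proof -
    have "t / (s + t) = 1 - s / (s + t)" using assms by (simp add: field_simps)
    then show ?thesis by (simp add: z_def scaleR_diff_left scaleR_diff_right)
  qed
  then have "dist b z = t / (s + t) * dist a b"
    using assms by (metis abs_of_pos add_pos_pos divide_pos_pos dist_commute dist_norm norm_scaleR)
  moreover have "dist a b / (s + t) < 1" using * assms by simp
  ultimately have "dist a z < s" "dist b z < t"
    using assms mult_strict_left_mono[of "dist a b / (s + t)" 1 s]
      mult_strict_left_mono[of "dist a b / (s + t)" 1 t] by auto
  then show False using assms(1) by auto
qed

text \<open>
  The point \<open>p\<close> lies on both spheres. Disjointness forces equality in the triangle inequality for the two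
  radius vectors at \<open>p\<close>, and equality means that they are parallel.
\<close>

lemma tangent_ball_centre:
  fixes p v :: "'a::euclidean_space"
  assumes "ball (p - r *\<^sub>R \<nu>) r \<inter> ball (p + v) (norm v) = {}" "norm \<nu> = 1" "0 < r"
  shows "v = norm v *\<^sub>R \<nu>"
proof (cases "v = 0")
  case False
  then have "r + norm v \<le> dist (p + v) (p - r *\<^sub>R \<nu>)"
    using disjoint_balls_dist_ge[OF assms(1)] assms(3) by (simp add: dist_commute)
  also have "\<dots> = norm (r *\<^sub>R \<nu> + v)" by (simp add: dist_norm algebra_simps)
  finally have "r + norm v \<le> norm (r *\<^sub>R \<nu> + v)" .
  moreover have norm_r: "norm (r *\<^sub>R \<nu>) = r" using assms(2,3) by simp
  ultimately have "norm (r *\<^sub>R \<nu> + v) = norm (r *\<^sub>R \<nu>) + norm v"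
    using norm_triangle_ineq[of "r *\<^sub>R \<nu>" v] by linarith
  then have "r *\<^sub>R v = norm v *\<^sub>R r *\<^sub>R \<nu>"
    using norm_triangle_eq[of "r *\<^sub>R \<nu>" v] by (simp only: norm_r simp_thms)
  then have "r *\<^sub>R v = r *\<^sub>R (norm v *\<^sub>R \<nu>)" by (simp only: scaleR_left_commute)
  then show ?thesis using assms(3) by (metis less_irrefl scaleR_left_imp_eq)
qed auto

text \<open>
  Along the segment the squared distance to \<open>c\<close> is its linear interpolation minus
  \<open>t (1 - t) |a - b|\<^sup>2\<close>; the extreme case is the midpoint of a chord of the sphere of radius \<open>R\<close>.
\<close>

lemma segment_sagitta:
  fixes a b c :: "'a::euclidean_space"
  assumes "u \<in> closed_segment a b" "R \<le> dist a c" "R \<le> dist b c" "0 \<le> R"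
  shows "R\<^sup>2 - (dist a b)\<^sup>2 / 4 \<le> (dist u c)\<^sup>2"
proof -
  obtain t where t: "0 \<le> t" "t \<le> 1" "u = (1 - t) *\<^sub>R a + t *\<^sub>R b"
    using assms(1) by (auto simp: closed_segment_def)
  have u: "u - c = (1 - t) *\<^sub>R (a - c) + t *\<^sub>R (b - c)"
    using t by (simp add: algebra_simps)
  have ab: "dist a b = norm ((a - c) - (b - c))" by (simp add: dist_norm)
  have "(dist u c)\<^sup>2 = (1 - t) * (dist a c)\<^sup>2 + t * (dist b c)\<^sup>2 - t * (1 - t) * (dist a b)\<^sup>2"
    unfolding ab dist_norm u power2_norm_eq_inner
    by (simp add: inner_commute power2_eq_square algebra_simps)
  moreover have "R\<^sup>2 \<le> (dist a c)\<^sup>2" "R\<^sup>2 \<le> (dist b c)\<^sup>2"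
    using assms by (auto intro: power_mono)
  then have "(1 - t) * R\<^sup>2 \<le> (1 - t) * (dist a c)\<^sup>2" "t * R\<^sup>2 \<le> t * (dist b c)\<^sup>2"
    using t by (auto intro: mult_left_mono)
  moreover have "t * (1 - t) \<le> 1 / 4"
    using zero_le_power2[of "t - 1/2"] by (simp add: power2_eq_square algebra_simps)
  then have "t * (1 - t) * (dist a b)\<^sup>2 \<le> 1 / 4 * (dist a b)\<^sup>2"
    by (rule mult_right_mono) auto
  ultimately show ?thesis by (simp add: algebra_simps)
qed

text \<open>
  The segment to the nearest point meets the frontier, and no frontier point on it can be nearer.
\<close>

lemma closest_point_in_frontier:
  fixes z :: "'a::euclidean_space"
  assumes "closed S" "S \<noteq> {}" "z \<notin> interior S"
  shows "closest_point S z \<in> frontier S"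
proof (cases "z \<in> S")
  case True
  then show ?thesis
    using assms by (simp add: closest_point_self frontier_def closure_closed)
next
  case False
  let ?p = "closest_point S z"
  have p: "?p \<in> S" using assms by (simp add: closest_point_in_set)
  then have "closed_segment z ?p \<inter> S \<noteq> {}" "closed_segment z ?p - S \<noteq> {}"
    using False by auto
  then obtain f where f: "f \<in> closed_segment z ?p" "f \<in> frontier S"
    using connected_Int_frontier[OF connected_segment(1)] by blast
  have "f \<in> S" using f(2) assms(1) by (simp add: frontier_def closure_closed)
  then have "dist z ?p \<le> dist z f" using assms(1) by (simp add: closest_point_le)
  moreover have "dist z ?p = dist z f + dist f ?p"
    using f(1) by (simp add: between_mem_segment[symmetric] between)
  ultimately have "f = ?p" by (metis add_le_same_cancel1 dist_le_zero_iff)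
  then show ?thesis using f(2) by simp
qed

section \<open>Domains with interior and exterior balls of a fixed radius\<close>

text \<open>
  The vector \<open>n p\<close> points outwards. For an empty frontier the conditions are void, and then \<open>\<Omega>\<close> is the
  whole space.
\<close>

locale two_sided_ball =
  fixes \<Omega> :: "'a::euclidean_space set" and n :: "'a \<Rightarrow> 'a" and r :: real
  assumes open_dom: "open \<Omega>" and nonempty_dom: "\<Omega> \<noteq> {}" and r_pos: "0 < r"
    and norm_n: "\<And>p. p \<in> frontier \<Omega> \<Longrightarrow> norm (n p) = 1"
    and inner_ball: "\<And>p. p \<in> frontier \<Omega> \<Longrightarrow> ball (p - r *\<^sub>R n p) r \<subseteq> \<Omega>"
    and outer_ball: "\<And>p. p \<in> frontier \<Omega> \<Longrightarrow> ball (p + r *\<^sub>R n p) r \<inter> \<Omega> = {}"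
begin

abbreviation proj :: "'a \<Rightarrow> 'a" where
  "proj \<equiv> closest_point (closure \<Omega>)"

lemma proj_in: "proj z \<in> closure \<Omega>"
  using nonempty_dom by (simp add: closest_point_in_set)

lemma proj_le: "q \<in> closure \<Omega> \<Longrightarrow> dist z (proj z) \<le> dist z q"
  by (simp add: closest_point_le)

lemma proj_self: "z \<in> closure \<Omega> \<Longrightarrow> proj z = z"
  by (simp add: closest_point_self)

lemma outer_ball_closure: "p \<in> frontier \<Omega> \<Longrightarrow> ball (p + r *\<^sub>R n p) r \<inter> closure \<Omega> = {}"
  using outer_ball by (simp add: open_Int_closure_eq_empty)

lemma proj_frontier:
  assumes "z \<notin> \<Omega>"
  shows "proj z \<in> frontier \<Omega>"
proof (cases "z \<in> closure \<Omega>")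
  case True
  then show ?thesis using assms open_dom by (simp add: proj_self frontier_def interior_open)
next
  case False
  have "z \<notin> interior (closure \<Omega>)" using False interior_subset by auto
  then have "proj z \<in> frontier (closure \<Omega>)"
    using nonempty_dom by (intro closest_point_in_frontier) auto
  then show ?thesis using interior_mono[OF closure_subset, of \<Omega>] by (auto simp: frontier_def)
qed

text \<open>
  The ball about \<open>z\<close> through its nearest point misses \<open>\<Omega>\<close>, hence touches the interior ball from outside.
\<close>

lemma proj_normal:
  assumes "z \<notin> \<Omega>"
  shows "z = proj z + dist z (proj z) *\<^sub>R n (proj z)"
proof -
  let ?p = "proj z"
  note p = proj_frontier[OF assms]
  have "ball z (dist z ?p) \<inter> closure \<Omega> = {}"
    using proj_le[of _ z] by force
  then have "ball (?p - r *\<^sub>R n ?p) r \<inter> ball (?p + (z - ?p)) (norm (z - ?p)) = {}"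
    using inner_ball[OF p] closure_subset[of \<Omega>] by (auto simp: dist_norm)
  from tangent_ball_centre[OF this norm_n[OF p] r_pos]
  have "z - ?p = dist z ?p *\<^sub>R n ?p" by (simp add: dist_norm)
  then show ?thesis by (metis add.commute diff_add_cancel)
qed

text \<open>
  This is the statement that \<open>q\<close> is outside the exterior ball at \<open>p\<close>, with the square expanded.
\<close>

lemma inner_normal_le:
  assumes "p \<in> frontier \<Omega>" "q \<in> closure \<Omega>"
  shows "n p \<bullet> (q - p) \<le> (dist p q)\<^sup>2 / (2 * r)"
proof -
  have "r \<le> norm ((q - p) - r *\<^sub>R n p)"
    using outer_ball_closure[OF assms(1)] assms(2)
    by (auto simp: dist_norm algebra_simps norm_minus_commute disjoint_iff not_less)
  then have "r\<^sup>2 \<le> (norm ((q - p) - r *\<^sub>R n p))\<^sup>2" using r_pos by (intro power_mono) auto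
  also have "\<dots> = (norm (q - p))\<^sup>2 - 2 * r * (n p \<bullet> (q - p)) + r\<^sup>2 * (norm (n p))\<^sup>2"
    by (simp only: power2_norm_eq_inner) (simp add: inner_commute algebra_simps power2_eq_square)
  finally have "2 * r * (n p \<bullet> (q - p)) \<le> (norm (q - p))\<^sup>2" using norm_n[OF assms(1)] by simp
  then show ?thesis using r_pos by (simp add: field_simps dist_norm norm_minus_commute)
qed

lemma inner_proj_le:
  assumes "q \<in> closure \<Omega>"
  shows "(z - proj z) \<bullet> (q - proj z) \<le> dist z (proj z) * (dist (proj z) q)\<^sup>2 / (2 * r)"
proof (cases "z \<in> \<Omega>")
  case True
  then have "proj z = z" using closure_subset proj_self by auto
  then show ?thesis by simp
next
  case False
  let ?p = "proj z"
  have z: "z - ?p = dist z ?p *\<^sub>R n ?p"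
    using proj_normal[OF False] by (metis add_diff_cancel_left')
  have "dist z ?p * (n ?p \<bullet> (q - ?p)) \<le> dist z ?p * ((dist ?p q)\<^sup>2 / (2 * r))"
    using inner_normal_le[OF proj_frontier[OF False] assms] by (intro mult_left_mono) auto
  then show ?thesis by (subst z) simp
qed

text \<open>
  Federer's argument for sets of positive reach: adding the one-sided estimates at the two nearest points
  gives \<open>(1 - h / r) d\<^sup>2 \<le> d * dist u v\<close> for their distance \<open>d\<close>.
\<close>

lemma proj_lipschitz:
  assumes "dist u (proj u) \<le> h" "dist v (proj v) \<le> h" "h < r"
  shows "dist (proj u) (proj v) \<le> r / (r - h) * dist u v"
proof -
  let ?p = "proj u" and ?q = "proj v"
  define d where "d = dist ?p ?q"
  have "(u - ?p) \<bullet> (?q - ?p) \<le> dist u ?p * d\<^sup>2 / (2 * r)"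
    using inner_proj_le[OF proj_in, of u v] by (simp add: d_def)
  also have "\<dots> \<le> h * d\<^sup>2 / (2 * r)"
    using assms r_pos by (intro divide_right_mono mult_right_mono) auto
  finally have 1: "(u - ?p) \<bullet> (?q - ?p) \<le> h * d\<^sup>2 / (2 * r)" .
  have "(v - ?q) \<bullet> (?p - ?q) \<le> dist v ?q * d\<^sup>2 / (2 * r)"
    using inner_proj_le[OF proj_in, of v u] by (simp add: d_def dist_commute)
  also have "\<dots> \<le> h * d\<^sup>2 / (2 * r)"
    using assms r_pos by (intro divide_right_mono mult_right_mono) auto
  finally have 2: "(v - ?q) \<bullet> (?p - ?q) \<le> h * d\<^sup>2 / (2 * r)" .
  have "(u - v) \<bullet> (?q - ?p) + d\<^sup>2 = (u - ?p) \<bullet> (?q - ?p) + (v - ?q) \<bullet> (?p - ?q)"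
    by (simp add: d_def dist_norm power2_norm_eq_inner algebra_simps inner_commute)
  also have "\<dots> \<le> h / r * d\<^sup>2" using 1 2 r_pos by (simp add: field_simps)
  finally have "d\<^sup>2 * (1 - h / r) \<le> (v - u) \<bullet> (?q - ?p)" by (simp add: algebra_simps)
  also have "\<dots> \<le> norm (v - u) * norm (?q - ?p)" by (rule norm_cauchy_schwarz)
  also have "\<dots> = dist u v * d" by (simp add: d_def dist_norm norm_minus_commute)
  finally have "d * (d * (1 - h / r)) \<le> d * dist u v"
    by (simp add: power2_eq_square algebra_simps)
  then have "d * (1 - h / r) \<le> dist u v"
    using mult_left_le_imp_le[of d "d * (1 - h / r)" "dist u v"] 
    by (cases "d = 0") (auto simp: d_def)
  moreover have "d * (1 - h / r) = d / (r / (r - h))" using assms(3) r_pos by (simp add: field_simps)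
  ultimately show ?thesis using assms(3) r_pos by (simp add: d_def field_simps)
qed

text \<open>
  A point of the segment outside \<open>\<Omega>\<close> is nearer than \<open>r\<close> to an end point, so it lies on the radius of the
  exterior ball at its nearest point. Both ends of the segment are at distance at least \<open>r\<close> from the centre.
\<close>

lemma segment_point_outer_centre:
  assumes "a \<in> closure \<Omega>" "b \<in> closure \<Omega>" "dist a b < 2 * r" "u \<in> closed_segment a b" "u \<notin> \<Omega>"
  obtains c where "ball c r \<inter> closure \<Omega> = {}" "dist u c = r - dist u (proj u)" "dist u (proj u) < r"
proof -
  let ?p = "proj u"
  define h where "h = dist u ?p"
  define c where "c = ?p + r *\<^sub>R n ?p"
  note p = proj_frontier[OF assms(5)]
  have "h \<le> dist u a" "h \<le> dist u b" unfolding h_def using assms(1,2) proj_le by auto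
  moreover have "dist u a + dist u b = dist a b"
    using assms(4) by (simp add: between_mem_segment[symmetric] between dist_commute)
  ultimately have h: "0 \<le> h" "h < r" using assms(3) by (auto simp: h_def)
  have "u - c = (h - r) *\<^sub>R n ?p"
    using proj_normal[OF assms(5)] by (simp add: c_def h_def algebra_simps)
  then have "dist u c = r - h" using h norm_n[OF p] by (simp add: dist_norm)
  then show ?thesis using that[of c] outer_ball_closure[OF p] h(2) by (simp add: c_def h_def)
qed

text \<open>
  If the segment left \<open>\<Omega>\<close>, it would be a chord entering an exterior ball, although its ends are at
  distance at least \<open>r + \<tau>\<close> from the centre; such a chord has length at least \<open>sqrt (8 r \<tau>)\<close>. The
  quadratic dependence is the point: short segments need only a much smaller inward margin.
\<close>

lemma segment_in_dom:
  assumes "ball a \<tau> \<subseteq> \<Omega>" "ball b \<tau> \<subseteq> \<Omega>" "0 < \<tau>" "dist a b < 2 * r" "(dist a b)\<^sup>2 < 8 * r * \<tau>"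
  shows "closed_segment a b \<subseteq> \<Omega>"
proof (rule subsetI, rule ccontr)
  fix u assume u: "u \<in> closed_segment a b" "u \<notin> \<Omega>"
  have ab: "a \<in> closure \<Omega>" "b \<in> closure \<Omega>"
    using assms centre_in_ball closure_subset by blast+
  obtain c where c: "ball c r \<inter> closure \<Omega> = {}" "dist u c = r - dist u (proj u)" "dist u (proj u) < r"
    using segment_point_outer_centre[OF ab assms(4) u] .
  have "ball c r \<inter> \<Omega> = {}" using c(1) closure_subset by blast
  then have ac: "\<tau> + r \<le> dist a c" "\<tau> + r \<le> dist b c"
    using assms(1-3) r_pos by (intro disjoint_balls_dist_ge; auto)+
  have "(\<tau> + r)\<^sup>2 - (dist a b)\<^sup>2 / 4 \<le> (dist u c)\<^sup>2"
    using segment_sagitta[OF u(1) ac] assms(3) r_pos by simp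
  moreover have "(dist u c)\<^sup>2 \<le> r\<^sup>2" using c(2,3) by (intro power_mono) auto
  moreover have "(\<tau> + r)\<^sup>2 = \<tau>\<^sup>2 + 2 * r * \<tau> + r\<^sup>2" by (simp add: power2_eq_square algebra_simps)
  ultimately have "\<tau>\<^sup>2 + 2 * r * \<tau> \<le> (dist a b)\<^sup>2 / 4" by simp
  then show False using assms(5) zero_le_power2[of \<tau>] by linarith
qed

lemma segment_near_dom:
  assumes "a \<in> closure \<Omega>" "b \<in> closure \<Omega>" "dist a b < 2 * r" "u \<in> closed_segment a b"
  shows "dist u (proj u) \<le> r - sqrt (r\<^sup>2 - (dist a b)\<^sup>2 / 4)"
proof (cases "u \<in> \<Omega>")
  case True
  then have "proj u = u" using closure_subset proj_self by auto
  moreover have "sqrt (r\<^sup>2 - (dist a b)\<^sup>2 / 4) \<le> sqrt (r\<^sup>2)" by (intro real_sqrt_le_mono) auto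
  ultimately show ?thesis using r_pos by simp
next
  case False
  obtain c where c: "ball c r \<inter> closure \<Omega> = {}" "dist u c = r - dist u (proj u)" "dist u (proj u) < r"
    using segment_point_outer_centre[OF assms False] .
  have ac: "r \<le> dist a c" "r \<le> dist b c"
  proof -
    have "a \<notin> ball c r" "b \<notin> ball c r" using c(1) assms(1,2) by blast+
    then show "r \<le> dist a c" "r \<le> dist b c" by (auto simp: dist_commute)
  qed
  have "r\<^sup>2 - (dist a b)\<^sup>2 / 4 \<le> (r - dist u (proj u))\<^sup>2"
    using segment_sagitta[OF assms(4) ac] r_pos c(2) by simp
  then have "sqrt (r\<^sup>2 - (dist a b)\<^sup>2 / 4) \<le> r - dist u (proj u)"
    using c(3) by (intro real_le_lsqrt) auto
  then show ?thesis by linarith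
qed

text \<open>
  A point at depth less than \<open>\<tau>\<close> is moved along the normal of the nearest frontier point until its
  depth is \<open>\<tau>\<close>; it stays inside the interior ball there. Only \<open>z\<close> itself may lie on the frontier.
\<close>

lemma push_inside:
  assumes "z \<in> closure \<Omega>" "0 < \<tau>" "\<tau> \<le> r"
  obtains w where "ball w \<tau> \<subseteq> \<Omega>" "dist z w \<le> \<tau>" "closed_segment z w \<subseteq> insert z \<Omega>"
proof (cases "ball z \<tau> \<subseteq> \<Omega>")
  case True
  moreover have "z \<in> \<Omega>" using True assms(2) by auto
  ultimately show ?thesis using that[of z] assms by simp
next
  case False
  then obtain y where "y \<in> ball z \<tau>" "y \<notin> \<Omega>" by blast
  let ?F = "- \<Omega>"
  have F: "closed ?F" "?F \<noteq> {}" using open_dom \<open>y \<notin> \<Omega>\<close> by auto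
  define p where "p = closest_point ?F z"
  define s where "s = dist z p"
  have "z \<notin> interior ?F" using assms(1) by (simp add: interior_closure)
  then have p: "p \<in> frontier \<Omega>"
    unfolding p_def using closest_point_in_frontier[OF F] frontier_complement[of \<Omega>] by auto
  have sle: "s \<le> dist z q" if "q \<notin> \<Omega>" for q
    unfolding s_def p_def using that F by (simp add: closest_point_le)
  have s: "0 \<le> s" "s < \<tau>" using sle[OF \<open>y \<notin> \<Omega>\<close>] \<open>y \<in> ball z \<tau>\<close> by (auto simp: s_def)
  have "ball z s \<subseteq> \<Omega>" using sle by force
  then have "ball (p - r *\<^sub>R (- n p)) r \<inter> ball (p + (z - p)) (norm (z - p)) = {}"
    using outer_ball[OF p] by (auto simp: s_def dist_norm)
  from tangent_ball_centre[OF this _ r_pos] norm_n[OF p]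
  have z: "z = p - s *\<^sub>R n p" by (simp add: s_def dist_norm algebra_simps)
  define w where "w = p - \<tau> *\<^sub>R n p"
  have "w - (p - r *\<^sub>R n p) = (r - \<tau>) *\<^sub>R n p" by (simp add: w_def algebra_simps)
  then have "dist w (p - r *\<^sub>R n p) = r - \<tau>" using norm_n[OF p] assms by (simp add: dist_norm)
  then have "ball w \<tau> \<subseteq> ball (p - r *\<^sub>R n p) r"
    by (simp add: ball_subset_ball_iff)
  then have 1: "ball w \<tau> \<subseteq> \<Omega>" using inner_ball[OF p] by auto
  have "z - w = (\<tau> - s) *\<^sub>R n p" by (simp add: z w_def algebra_simps)
  then have 2: "dist z w \<le> \<tau>" using norm_n[OF p] s by (simp add: dist_norm)
  have 3: "v \<in> insert z \<Omega>" if v_in: "v \<in> closed_segment z w" for v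
  proof -
    obtain t where t: "0 \<le> t" "t \<le> 1" "v = (1 - t) *\<^sub>R z + t *\<^sub>R w"
      using v_in by (auto simp: closed_segment_def)
    define k where "k = (1 - t) * s + t * \<tau>"
    have v: "v = p - k *\<^sub>R n p" by (simp add: t z w_def k_def algebra_simps)
    show ?thesis
    proof (cases "t = 0")
      case False
      have "0 < t * \<tau>" "0 \<le> (1 - t) * s" "t * \<tau> \<le> t * r" "(1 - t) * s \<le> (1 - t) * r"
        using False t s assms by (auto intro: mult_left_mono)
      then have k: "0 < k" "k \<le> r" by (auto simp: k_def algebra_simps)
      have "(p - r *\<^sub>R n p) - v = (k - r) *\<^sub>R n p" by (simp add: v algebra_simps)
      then have "dist (p - r *\<^sub>R n p) v = \<bar>k - r\<bar>" using norm_n[OF p] by (simp add: dist_norm)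
      then have "v \<in> ball (p - r *\<^sub>R n p) r" using k r_pos by auto
      then show ?thesis using inner_ball[OF p] by auto
    qed (simp add: t)
  qed
  show ?thesis using that[OF 1 2] 3 by auto
qed

text \<open>
  Divide the segment into \<open>N\<close> parts, project, and push the projected points to depth
  \<open>\<tau> = A\<^sup>2 / (r N\<^sup>2)\<close>, where \<open>A\<close> bounds the total length of the projected polygon. The sides have length
  about \<open>A / N\<close>, so this depth suffices to keep them inside \<open>\<Omega>\<close>, while the total cost of pushing is of
  order \<open>N \<tau>\<close> and tends to \<open>0\<close>. With \<open>S = \<Omega>\<close> this serves the upper bound, with \<open>S = closure \<Omega>\<close> the
  lower bound.
\<close>

lemma projected_segment_chain:
  assumes "\<And>z. z \<in> closed_segment u v \<Longrightarrow> dist z (proj z) \<le> h" "h < r"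
    and "\<Omega> \<subseteq> S" "S \<subseteq> closure \<Omega>" "proj u \<in> S" "proj v \<in> S" "0 < \<eta>"
  shows "polygonal_chain S (proj u) (proj v) (r / (r - h) * dist u v + \<eta>)"
proof (cases "u = v")
  case True
  then show ?thesis using assms by (auto intro: polygonal_chain.trivial_chain)
next
  case False
  define A where "A = r / (r - h) * dist u v"
  have A: "0 < A" using False assms(2) r_pos by (auto simp: A_def)
  define \<tau> where "\<tau> = (\<lambda>N::nat. A\<^sup>2 / (r * (real N)\<^sup>2))"
  have "(\<lambda>N. 2 * (real N + 1) * \<tau> N) \<longlonglongrightarrow> 0"
    unfolding \<tau>_def using r_pos by real_asymp
  then have e1: "eventually (\<lambda>N. 2 * (real N + 1) * \<tau> N < \<eta>) sequentially"
    using assms(7) by (rule order_tendstoD)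
  have e2: "eventually (\<lambda>N. 2 * A / r < real N) sequentially"
    using filterlim_real_sequentially by (auto simp: filterlim_at_top_dense)
  obtain N where N: "2 * (real N + 1) * \<tau> N < \<eta>" "2 * A / r < real N"
    using eventually_conj[OF e1 e2] by (auto simp: eventually_sequentially)
  have N0: "0 < real N" using N(2) A r_pos by (smt (verit) divide_pos_pos)
  define t where "t = \<tau> N"
  have AN: "A / N < r / 2" using N(2) N0 A r_pos by (simp add: field_simps)
  have t0: "0 < t" using A N0 r_pos by (simp add: t_def \<tau>_def)
  have t_alt: "t = (A / N) * (A / N) / r" by (simp add: t_def \<tau>_def power2_eq_square)
  have "t \<le> (A / N) * (r / 2) / r"
    unfolding t_alt using AN A r_pos N0 by (intro divide_right_mono mult_left_mono) auto
  then have t1: "2 * t \<le> A / N" using r_pos by simp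
  have tr: "t \<le> r" using t1 AN t0 r_pos by linarith
  define z where "z = (\<lambda>i::nat. proj (u + (real i / N) *\<^sub>R (v - u)))"
  have seg: "u + (real i / N) *\<^sub>R (v - u) \<in> closed_segment u v" if "i \<le> N" for i
    unfolding closed_segment_def
    using that N0 by (auto intro!: exI[of _ "real i / N"] simp: algebra_simps)
  have zin: "z i \<in> closure \<Omega>" for i by (simp add: z_def proj_in)
  have zz: "dist (z i) (z (Suc i)) \<le> A / N" if "Suc i \<le> N" for i
  proof -
    have "dist (z i) (z (Suc i)) \<le>
        r / (r - h) * dist (u + (real i / N) *\<^sub>R (v - u)) (u + (real (Suc i) / N) *\<^sub>R (v - u))"
      unfolding z_def using that assms by (intro proj_lipschitz) (auto intro!: assms(1) seg simp del: of_nat_Suc)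
    also have "dist (u + (real i / N) *\<^sub>R (v - u)) (u + (real (Suc i) / N) *\<^sub>R (v - u)) =
        \<bar>real i / N - real (Suc i) / N\<bar> * dist u v"
      by (simp add: dist_norm norm_minus_commute flip: scaleR_diff_left)
    also have "\<bar>real i / N - real (Suc i) / N\<bar> = 1 / N"
      using N0 by (simp add: field_simps)
    finally show ?thesis by (simp add: A_def)
  qed
  have "\<exists>w. ball w t \<subseteq> \<Omega> \<and> dist (z i) w \<le> t \<and> closed_segment (z i) w \<subseteq> insert (z i) \<Omega>" for i
    using push_inside[OF zin t0 tr] by metis
  then obtain w where w: "\<And>i. ball (w i) t \<subseteq> \<Omega>" "\<And>i. dist (z i) (w i) \<le> t"
    "\<And>i. closed_segment (z i) (w i) \<subseteq> insert (z i) \<Omega>" by metis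
  have ww: "dist (w i) (w (Suc i)) \<le> A / N + 2 * t" if "Suc i \<le> N" for i
  proof -
    have "dist (w i) (w (Suc i)) \<le> dist (w i) (z i) + dist (z i) (z (Suc i)) + dist (z (Suc i)) (w (Suc i))"
      by metric
    then show ?thesis using zz[OF that] w(2)[of i] w(2)[of "Suc i"] by (simp add: dist_commute)
  qed
  have wseg: "closed_segment (w i) (w (Suc i)) \<subseteq> S" if "Suc i \<le> N" for i
  proof -
    have d: "dist (w i) (w (Suc i)) \<le> 2 * (A / N)" using ww[OF that] t1 by simp
    then have "(dist (w i) (w (Suc i)))\<^sup>2 \<le> (2 * (A / N))\<^sup>2" by (intro power_mono) auto
    also have "\<dots> = 4 * r * t" using r_pos by (simp add: t_alt power2_eq_square)
    also have "\<dots> < 8 * r * t" using r_pos t0 by simp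
    finally have sq: "(dist (w i) (w (Suc i)))\<^sup>2 < 8 * r * t" .
    have "dist (w i) (w (Suc i)) < 2 * r" using d AN r_pos by linarith
    from segment_in_dom[OF w(1) w(1) t0 this sq]
    have "closed_segment (w i) (w (Suc i)) \<subseteq> \<Omega>" .
    then show ?thesis using assms(3) by auto
  qed
  have z0: "z 0 = proj u" and zN: "z N = proj v" using N0 by (auto simp: z_def)
  have chain: "polygonal_chain S (proj u) (w i) (t + i * (A / N + 2 * t))" if "i \<le> N" for i
    using that
  proof (induction i)
    case 0
    show ?case using w(2,3)[of 0] assms by (auto simp: z0 intro!: polygonal_chain_segment)
  next
    case (Suc i)
    then have "polygonal_chain S (proj u) (w i) (t + i * (A / N + 2 * t))" by simp
    from this wseg[OF Suc.prems] show ?case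
    proof (rule polygonal_chain.extend_chain)
      have "t + i * (A / N + 2 * t) + (A / N + 2 * t) = t + Suc i * (A / N + 2 * t)"
        by (simp only: of_nat_Suc distrib_right mult_1_left ac_simps)
      then show "t + i * (A / N + 2 * t) + dist (w i) (w (Suc i)) \<le> t + Suc i * (A / N + 2 * t)"
        using ww[OF Suc.prems] by linarith
    qed
  qed
  have "closed_segment (w N) (proj v) \<subseteq> S"
    using w(3)[of N] assms(3,6) by (auto simp: zN closed_segment_commute)
  moreover have "dist (w N) (proj v) \<le> t" using w(2)[of N] by (simp add: zN dist_commute)
  moreover have "N * (A / N) = A" using N0 by simp
  then have "t + N * (A / N + 2 * t) + t = A + 2 * (real N + 1) * t"
    by (simp add: algebra_simps)
  ultimately have "polygonal_chain S (proj u) (proj v) (A + \<eta>)"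
    using N(1) by (intro polygonal_chain.extend_chain[OF chain[of N]]) (auto simp: t_def)
  then show ?thesis by (simp add: A_def)
qed

lemma nearby_chain:
  assumes "\<Omega> \<subseteq> S" "S \<subseteq> closure \<Omega>" "a \<in> S" "b \<in> S" "dist a b < 2 * r" "0 < \<eta>"
  shows "polygonal_chain S a b (r / sqrt (r\<^sup>2 - (dist a b)\<^sup>2 / 4) * dist a b + \<eta>)"
proof -
  have ab: "a \<in> closure \<Omega>" "b \<in> closure \<Omega>" using assms by auto
  have "(dist a b)\<^sup>2 < (2 * r)\<^sup>2" using assms(5) by (intro power_strict_mono) auto
  then have "0 < sqrt (r\<^sup>2 - (dist a b)\<^sup>2 / 4)" by simp
  then show ?thesis
    using projected_segment_chain[of a b "r - sqrt (r\<^sup>2 - (dist a b)\<^sup>2 / 4)" S \<eta>]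
      segment_near_dom[OF ab assms(5)] assms by (simp add: proj_self ab)
qed

end

text \<open>
  Each of the two balls is connected and misses the frontier, so it lies in \<open>\<Omega>\<close> or misses \<open>\<Omega>\<close>; the
  points \<open>p \<mp> t n\<close> with small \<open>t\<close> decide which.
\<close>

lemma two_sided_ballI_normal:
  fixes \<Omega> :: "'a::euclidean_space set"
  assumes "open \<Omega>" "\<Omega> \<noteq> {}" "0 < r"
    and n: "\<And>p. p \<in> frontier \<Omega> \<Longrightarrow> outward_unit_normal \<Omega> p (n p)"
    and balls: "\<And>p. p \<in> frontier \<Omega> \<Longrightarrow>
           ball (p + r *\<^sub>R n p) r \<inter> frontier \<Omega> = {} \<and> ball (p - r *\<^sub>R n p) r \<inter> frontier \<Omega> = {}"
  shows "two_sided_ball \<Omega> n r"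
proof
  fix p assume p: "p \<in> frontier \<Omega>"
  show norm: "norm (n p) = 1" using n[OF p] by (simp add: outward_unit_normal_def)
  obtain e where e: "0 < e" "\<And>t. 0 < t \<Longrightarrow> t < e \<Longrightarrow> p - t *\<^sub>R n p \<in> \<Omega> \<and> p + t *\<^sub>R n p \<notin> closure \<Omega>"
    using n[OF p] unfolding outward_unit_normal_def by metis
  define t where "t = min (e / 2) r"
  have t: "0 < t" "t < e" "t \<le> r" using e(1) \<open>0 < r\<close> by (auto simp: t_def)
  have "(p - r *\<^sub>R n p) - (p - t *\<^sub>R n p) = (t - r) *\<^sub>R n p" by (simp add: algebra_simps)
  then have "dist (p - r *\<^sub>R n p) (p - t *\<^sub>R n p) < r" using norm t by (simp add: dist_norm)
  then have in1: "p - t *\<^sub>R n p \<in> ball (p - r *\<^sub>R n p) r" by simp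
  have "(p + r *\<^sub>R n p) - (p + t *\<^sub>R n p) = (r - t) *\<^sub>R n p" by (simp add: algebra_simps)
  then have "dist (p + r *\<^sub>R n p) (p + t *\<^sub>R n p) < r" using norm t by (simp add: dist_norm)
  then have in2: "p + t *\<^sub>R n p \<in> ball (p + r *\<^sub>R n p) r" by simp
  have e1: "p - t *\<^sub>R n p \<in> \<Omega>" and e2: "p + t *\<^sub>R n p \<notin> \<Omega>"
    using e(2)[OF t(1,2)] closure_subset by blast+
  show "ball (p - r *\<^sub>R n p) r \<subseteq> \<Omega>"
    using connected_Int_frontier[of "ball (p - r *\<^sub>R n p) r" \<Omega>] balls[OF p] in1 e1 connected_ball by blast
  show "ball (p + r *\<^sub>R n p) r \<inter> \<Omega> = {}"
    using connected_Int_frontier[of "ball (p + r *\<^sub>R n p) r" \<Omega>] balls[OF p] in2 e2 connected_ball by blast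
qed (use assms in auto)

section \<open>Partial derivatives and functions supported in a ball\<close>

lemma has_derivative_pderiv_dir:
  fixes g :: "real ^ 'n::finite \<Rightarrow> real"
  assumes "(g has_derivative g') (at x)"
  shows "pderiv_dir a g x = g' (axis a 1)"
proof -
  have "((\<lambda>t::real. x + t *\<^sub>R axis a 1) has_derivative (\<lambda>t. t *\<^sub>R axis a 1)) (at 0)"
    by (auto intro!: derivative_eq_intros)
  then have "((\<lambda>t. g (x + t *\<^sub>R axis a 1)) has_derivative (\<lambda>t. g' (t *\<^sub>R axis a 1))) (at 0)"
    using assms by (intro has_derivative_compose[of _ _ 0 UNIV g g']) auto
  moreover have "g' (t *\<^sub>R axis a 1) = g' (axis a 1) * t" for t
    using linear_cmul[OF has_derivative_linear[OF assms]] by (simp add: mult.commute)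
  ultimately have "((\<lambda>t. g (x + t *\<^sub>R axis a 1)) has_field_derivative g' (axis a 1)) (at 0)"
    by (simp add: has_field_derivative_def)
  then show ?thesis unfolding pderiv_dir_def by (rule DERIV_imp_deriv)
qed

text \<open>
  For a differentiable function the partial derivatives along coordinate lines are the entries of the
  total derivative.
\<close>

lemma has_derivative_grad:
  fixes g :: "real ^ 'n::finite \<Rightarrow> real"
  assumes "g differentiable (at x)"
  shows "(g has_derivative (\<lambda>h. grad g x \<bullet> h)) (at x)"
proof -
  obtain g' where g': "(g has_derivative g') (at x)"
    using assms by (auto simp: differentiable_def)
  have "g' h = grad g x \<bullet> h" for h
  proof -
    have "g' h = g' (\<Sum>a\<in>UNIV. h $ a *\<^sub>R axis a 1)"
      using basis_expansion[of h] by (simp add: scalar_mult_eq_scaleR)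
    also have "\<dots> = (\<Sum>a\<in>UNIV. h $ a * g' (axis a 1))"
      using has_derivative_linear[OF g'] by (simp add: linear_sum linear_cmul)
    also have "\<dots> = grad g x \<bullet> h"
      by (simp add: inner_vec_def grad_def has_derivative_pderiv_dir[OF g'] mult.commute)
    finally show ?thesis .
  qed
  then have "g' = (\<lambda>h. grad g x \<bullet> h)" by auto
  then show ?thesis using g' by simp
qed

lemma smooth_on_pderiv_dir: "smooth_on S f \<Longrightarrow> smooth_on S (pderiv_dir a f)"
  unfolding smooth_on_def using Ck_on.simps(2) by blast

lemma smooth_on_differentiable_on: "smooth_on S f \<Longrightarrow> f differentiable_on S"
  unfolding smooth_on_def using Ck_on.simps(2) by blast

lemma smooth_on_continuous_on: "smooth_on S f \<Longrightarrow> continuous_on S f"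
  unfolding smooth_on_def using Ck_on.simps(1) by blast

lemma pderiv_dir_eq_0:
  assumes "closed C" "\<And>x. x \<notin> C \<Longrightarrow> g x = 0" "x \<notin> C"
  shows "pderiv_dir a g x = 0"
proof -
  have "eventually (\<lambda>y. y \<in> - C) (nhds x)"
    using assms by (intro eventually_nhds_in_open) auto
  then have "eventually (\<lambda>y. g y = 0) (nhds x)"
    by eventually_elim (use assms in auto)
  moreover have "((\<lambda>t. x + t *\<^sub>R axis a 1) \<longlongrightarrow> x) (nhds (0::real))"
    by (auto intro!: tendsto_eq_intros filterlim_ident)
  ultimately have "eventually (\<lambda>t. g (x + t *\<^sub>R axis a 1) = 0) (nhds (0::real))"
    unfolding filterlim_iff by blast
  then have "deriv (\<lambda>t. g (x + t *\<^sub>R axis a 1)) 0 = deriv (\<lambda>t. 0::real) 0"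
    by (intro deriv_cong_ev) auto
  then show ?thesis by (simp add: pderiv_dir_def)
qed

text \<open>
  Every mollifier belongs to this class for some \<open>\<rho> < 1\<close>; unlike the mollifiers, the class is closed under
  partial derivatives.
\<close>

definition smooth_within :: "real \<Rightarrow> (real ^ 'n::finite \<Rightarrow> real) \<Rightarrow> bool" where
  "smooth_within \<rho> g \<longleftrightarrow> smooth_on UNIV g \<and> (\<forall>x. x \<notin> cball 0 \<rho> \<longrightarrow> g x = 0)"

lemma smooth_within_pderiv_dir: "smooth_within \<rho> g \<Longrightarrow> smooth_within \<rho> (pderiv_dir a g)"
  unfolding smooth_within_def using pderiv_dir_eq_0[OF closed_cball] smooth_on_pderiv_dir by blast

lemma smooth_within_continuous: "smooth_within \<rho> g \<Longrightarrow> continuous_on UNIV g"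
  by (simp add: smooth_within_def smooth_on_continuous_on)

lemma smooth_within_integrable_mult:
  fixes g :: "real ^ 'n::finite \<Rightarrow> real"
  assumes "smooth_within \<rho> g" "f \<in> borel_measurable borel" "\<And>x. \<bar>f x\<bar> \<le> M"
  shows "integrable lborel (\<lambda>z. g z * f z)"
proof -
  have cont: "continuous_on UNIV g" using assms(1) by (rule smooth_within_continuous)
  have "compact (g ` cball 0 \<rho>)"
    by (intro compact_continuous_image continuous_on_subset[OF cont]) auto
  then obtain B where B: "\<And>z. z \<in> cball 0 \<rho> \<Longrightarrow> \<bar>g z\<bar> \<le> B"
    using compact_imp_bounded by (fastforce simp: bounded_iff)
  have "\<bar>g z * f z\<bar> \<le> B * M" if "z \<in> cball 0 \<rho>" for z
    unfolding abs_mult using B[OF that] assms(3)[of z] by (intro mult_mono) auto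
  moreover have "g \<in> borel_measurable borel" using cont by (rule borel_measurable_continuous_onI)
  ultimately show ?thesis
    using assms emeasure_lborel_cball_finite[of "0 :: real ^ 'n" \<rho>]
    by (intro integrableI_bounded_set[of "cball 0 \<rho>" _ _ "B * M"])
      (auto simp: smooth_within_def)
qed

section \<open>Lengths of curves\<close>

text \<open>
  The competitors in \<open>riem_dist\<close> for \<open>S = closure \<Omega>\<close>, with their exact length \<open>l\<close>.
\<close>

definition joined_by_curve :: "'a::euclidean_space set \<Rightarrow> 'a \<Rightarrow> 'a \<Rightarrow> real \<Rightarrow> bool" where
  "joined_by_curve S x y l \<longleftrightarrow> (\<exists>\<gamma>. valid_path \<gamma> \<and> pathstart \<gamma> = x \<and> pathfinish \<gamma> = y \<and>
     path_image \<gamma> \<subseteq> S \<and> ((\<lambda>t. norm (vector_derivative \<gamma> (at t))) has_integral l) {0..1})"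

text \<open>
  The two halves are rescaled copies of the speeds of the parts, except at the finitely many parameters
  where one of the parts is not differentiable and at \<open>1/2\<close>.
\<close>

lemma speed_join:
  fixes g1 g2 :: "real \<Rightarrow> 'a::euclidean_space"
  assumes "valid_path g1" "valid_path g2"
    and l1: "((\<lambda>t. norm (vector_derivative g1 (at t))) has_integral l1) {0..1}"
    and l2: "((\<lambda>t. norm (vector_derivative g2 (at t))) has_integral l2) {0..1}"
  shows "((\<lambda>t. norm (vector_derivative (g1 +++ g2) (at t))) has_integral (l1 + l2)) {0..1}"
proof -
  obtain s1 where s1: "finite s1" "\<forall>t\<in>{0..1} - s1. g1 differentiable at t"
    using assms(1) by (auto simp: valid_path_def piecewise_C1_differentiable_on_def C1_differentiable_on_eq)
  obtain s2 where s2: "finite s2" "\<forall>t\<in>{0..1} - s2. g2 differentiable at t"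
    using assms(2) by (auto simp: valid_path_def piecewise_C1_differentiable_on_def C1_differentiable_on_eq)
  have "((\<lambda>t. norm (vector_derivative g1 (at (2 *\<^sub>R t + 0)))) has_integral
      (1 / \<bar>2\<bar> ^ DIM(real)) *\<^sub>R l1) ((\<lambda>t. (1 / 2) *\<^sub>R t + - ((1 / 2) *\<^sub>R 0)) ` cbox 0 1)"
    using has_integral_affinity[of "\<lambda>t. norm (vector_derivative g1 (at t))" l1 0 1 2 0] l1 by simp
  moreover have "(\<lambda>t::real. (1 / 2) *\<^sub>R t + - ((1 / 2) *\<^sub>R 0)) ` cbox 0 1 = {0..1/2}"
    using image_affinity_atLeastAtMost[of "1/2" 0 0 "1::real"] by simp
  ultimately have "((\<lambda>t. norm (vector_derivative g1 (at (2 * t)))) has_integral l1 / 2) {0..1/2}"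
    by simp
  from has_integral_mult_right[OF this, of 2]
  have i1: "((\<lambda>t. 2 * norm (vector_derivative g1 (at (2 * t)))) has_integral l1) {0..1/2}" by simp
  have "((\<lambda>t. norm (vector_derivative g2 (at (2 *\<^sub>R t + -1)))) has_integral
      (1 / \<bar>2\<bar> ^ DIM(real)) *\<^sub>R l2) ((\<lambda>t. (1 / 2) *\<^sub>R t + - ((1 / 2) *\<^sub>R -1)) ` cbox 0 1)"
    using has_integral_affinity[of "\<lambda>t. norm (vector_derivative g2 (at t))" l2 0 1 2 "-1"] l2 by simp
  moreover have "(\<lambda>t::real. (1 / 2) *\<^sub>R t + - ((1 / 2) *\<^sub>R -1)) ` cbox 0 1 = {1/2..1}"
    using image_affinity_atLeastAtMost[of "1/2" "1/2" 0 "1::real"] by simp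
  ultimately have "((\<lambda>t. norm (vector_derivative g2 (at (2 * t - 1)))) has_integral l2 / 2) {1/2..1}"
    by simp
  from has_integral_mult_right[OF this, of 2]
  have i2: "((\<lambda>t. 2 * norm (vector_derivative g2 (at (2 * t - 1)))) has_integral l2) {1/2..1}" by simp
  have d1: "norm (vector_derivative (g1 +++ g2) (at t)) = 2 * norm (vector_derivative g1 (at (2 * t)))"
    if t: "t \<in> {0..1/2} - ((\<lambda>t. t / 2) ` s1 \<union> {1/2})" for t
  proof -
    have "2 * t \<notin> s1"
    proof
      assume "2 * t \<in> s1"
      then have "2 * t / 2 \<in> (\<lambda>t. t / 2) ` s1" by (rule imageI)
      then show False using t by simp
    qed
    then have "g1 differentiable at (2 * t)" using s1(2) t by auto
    then have "(g1 has_vector_derivative vector_derivative g1 (at (2 * t))) (at (2 * t))"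
      by (simp add: vector_derivative_works)
    moreover have "((\<lambda>t. 2 * t) has_vector_derivative 2) (at t)"
      by (auto intro!: derivative_eq_intros)
    ultimately have "((g1 \<circ> (\<lambda>t. 2 * t)) has_vector_derivative 2 *\<^sub>R vector_derivative g1 (at (2 * t))) (at t)"
      by (intro vector_diff_chain_at)
    then have "((g1 +++ g2) has_vector_derivative 2 *\<^sub>R vector_derivative g1 (at (2 * t))) (at t)"
      by (rule has_vector_derivative_transform_within_open[of _ _ _ "{..<1/2}"])
        (use t in \<open>auto simp: joinpaths_def\<close>)
    then show ?thesis by (simp add: vector_derivative_at)
  qed
  have d2: "norm (vector_derivative (g1 +++ g2) (at t)) = 2 * norm (vector_derivative g2 (at (2 * t - 1)))"
    if t: "t \<in> {1/2..1} - ((\<lambda>t. (t + 1) / 2) ` s2 \<union> {1/2})" for t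
  proof -
    have "2 * t - 1 \<notin> s2"
    proof
      assume "2 * t - 1 \<in> s2"
      then have "(2 * t - 1 + 1) / 2 \<in> (\<lambda>t. (t + 1) / 2) ` s2" by (rule imageI)
      then show False using t by simp
    qed
    then have "g2 differentiable at (2 * t - 1)" using s2(2) t by auto
    then have "(g2 has_vector_derivative vector_derivative g2 (at (2 * t - 1))) (at (2 * t - 1))"
      by (simp add: vector_derivative_works)
    moreover have "((\<lambda>t. 2 * t - 1) has_vector_derivative 2) (at t)"
      by (auto intro!: derivative_eq_intros)
    ultimately have "((g2 \<circ> (\<lambda>t. 2 * t - 1)) has_vector_derivative 2 *\<^sub>R vector_derivative g2 (at (2 * t - 1))) (at t)"
      by (intro vector_diff_chain_at)
    then have "((g1 +++ g2) has_vector_derivative 2 *\<^sub>R vector_derivative g2 (at (2 * t - 1))) (at t)"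
      by (rule has_vector_derivative_transform_within_open[of _ _ _ "{1/2<..}"])
        (use t in \<open>auto simp: joinpaths_def\<close>)
    then show ?thesis by (simp add: vector_derivative_at)
  qed
  have "((\<lambda>t. norm (vector_derivative (g1 +++ g2) (at t))) has_integral l1) {0..1/2}"
    by (rule has_integral_spike_finite[of "(\<lambda>t. t / 2) ` s1 \<union> {1/2}", OF _ d1 i1])
      (use s1 in auto)
  moreover have "((\<lambda>t. norm (vector_derivative (g1 +++ g2) (at t))) has_integral l2) {1/2..1}"
    by (rule has_integral_spike_finite[of "(\<lambda>t. (t + 1) / 2) ` s2 \<union> {1/2}", OF _ d2 i2]) (use s2 in auto)
  ultimately show ?thesis
    by (intro has_integral_combine[of 0 "1/2" 1]) auto
qed

lemma polygonal_chain_imp_link: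
  assumes "polygonal_chain S x y l"
  shows "\<exists>l'\<le>l. joined_by_curve S x y l'"
  using assms
proof (induction)
  case (trivial_chain l)
  have "((\<lambda>t. norm (vector_derivative (linepath x x) (at t))) has_integral 0) {0..1}" by simp
  then have "joined_by_curve S x x 0"
    using trivial_chain unfolding joined_by_curve_def
    by (intro exI[of _ "linepath x x"]) auto
  then show ?case using trivial_chain by auto
next
  case (extend_chain y l z l')
  then obtain l1 \<gamma> where l1: "l1 \<le> l" and \<gamma>: "valid_path \<gamma>" "pathstart \<gamma> = x" "pathfinish \<gamma> = y"
     "path_image \<gamma> \<subseteq> S" "((\<lambda>t. norm (vector_derivative \<gamma> (at t))) has_integral l1) {0..1}"
    by (auto simp: joined_by_curve_def)
  have "((\<lambda>t::real. dist y z) has_integral dist y z) {0..1}"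
    using has_integral_const_real[of "dist y z" 0 1] by simp
  then have "((\<lambda>t. norm (vector_derivative (linepath y z) (at t))) has_integral dist y z) {0..1}"
    by (simp add: dist_norm norm_minus_commute)
  then have "((\<lambda>t. norm (vector_derivative (\<gamma> +++ linepath y z) (at t))) has_integral l1 + dist y z) {0..1}"
    using \<gamma> by (intro speed_join) auto
  then have "joined_by_curve S x z (l1 + dist y z)"
    using \<gamma> extend_chain(2) unfolding joined_by_curve_def
    by (intro exI[of _ "\<gamma> +++ linepath y z"]) (auto simp: valid_path_join path_image_join)
  then show ?case using l1 extend_chain(3) by (intro exI[of _ "l1 + dist y z"]) auto
qed

lemma dist_le_integral_speed:
  fixes \<gamma> :: "real \<Rightarrow> 'a::euclidean_space"
  assumes "valid_path \<gamma>" "(\<lambda>t. norm (vector_derivative \<gamma> (at t))) integrable_on {0..1}"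
    and "0 \<le> a" "a \<le> b" "b \<le> 1"
  shows "dist (\<gamma> a) (\<gamma> b) \<le> integral {a..b} (\<lambda>t. norm (vector_derivative \<gamma> (at t)))"
proof -
  obtain s where s: "finite s" "\<forall>t\<in>{0..1} - s. \<gamma> differentiable at t" and cont: "continuous_on {0..1} \<gamma>"
    using assms(1) by (auto simp: valid_path_def piecewise_C1_differentiable_on_def C1_differentiable_on_eq)
  have sub: "{a..b} \<subseteq> {0..1}" using assms by auto
  have "((\<lambda>t. vector_derivative \<gamma> (at t)) has_integral (\<gamma> b - \<gamma> a)) {a..b}"
  proof (rule fundamental_theorem_of_calculus_interior_strong[OF s(1) \<open>a \<le> b\<close>])
    show "(\<gamma> has_vector_derivative vector_derivative \<gamma> (at t)) (at t)" if "t \<in> {a<..<b} - s" for t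
      using that s(2) assms by (auto simp: vector_derivative_works[symmetric])
    show "continuous_on {a..b} \<gamma>" using cont sub by (rule continuous_on_subset)
  qed
  moreover have "(\<lambda>t. norm (vector_derivative \<gamma> (at t))) integrable_on {a..b}"
    using assms(2) sub by (rule integrable_on_subinterval)
  ultimately have "norm (integral {a..b} (\<lambda>t. vector_derivative \<gamma> (at t)))
      \<le> integral {a..b} (\<lambda>t. norm (vector_derivative \<gamma> (at t)))"
    by (intro integral_norm_bound_integral) auto
  moreover have "integral {a..b} (\<lambda>t. vector_derivative \<gamma> (at t)) = \<gamma> b - \<gamma> a"
    using \<open>(_ has_integral _) {a..b}\<close> by (rule integral_unique)
  ultimately show ?thesis by (simp add: dist_norm norm_minus_commute)
qed

lemma joined_by_curve_nonneg: "joined_by_curve S x y l \<Longrightarrow> 0 \<le> l"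
  unfolding joined_by_curve_def by (auto intro: has_integral_nonneg)

lemma riem_dist_eq: "riem_dist \<Omega> x y = Inf {l. joined_by_curve (closure \<Omega>) x y l}"
proof -
  have "{curve_length \<gamma> | \<gamma>. valid_path \<gamma> \<and> pathstart \<gamma> = x \<and> pathfinish \<gamma> = y \<and>
            path_image \<gamma> \<subseteq> closure \<Omega> \<and>
            (\<lambda>t. norm (vector_derivative \<gamma> (at t))) integrable_on {0..1}}
     = {l. joined_by_curve (closure \<Omega>) x y l}"
    unfolding joined_by_curve_def curve_length_def has_integral_iff
    by (intro Collect_cong) metis
  then show ?thesis by (simp add: riem_dist_def)
qed

lemma riem_dist_le: "joined_by_curve (closure \<Omega>) x y l \<Longrightarrow> riem_dist \<Omega> x y \<le> l"
  unfolding riem_dist_eq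
  by (rule cInf_lower) (auto intro!: bdd_belowI[of _ 0] dest: joined_by_curve_nonneg)

lemma riem_dist_le_chain: "polygonal_chain (closure \<Omega>) x y l \<Longrightarrow> riem_dist \<Omega> x y \<le> l"
  by (drule polygonal_chain_imp_link) (blast intro: order_trans riem_dist_le)

lemma riem_dist_le_chain_dist:
  "polygonal_chain (closure \<Omega>) x y l \<Longrightarrow> riem_dist \<Omega> x y \<le> chain_dist (closure \<Omega>) x y"
  unfolding chain_dist_def by (rule cInf_greatest) (auto intro: riem_dist_le_chain)

section \<open>The upper bound\<close>

context two_sided_ball
begin

lemma chain_lipschitz_nearby:
  assumes F: "\<And>p q l. polygonal_chain \<Omega> p q l \<Longrightarrow> F q - F p \<le> l" and "1 < \<kappa>"
  obtains \<delta> where "0 < \<delta>"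
    "\<And>p q. p \<in> \<Omega> \<Longrightarrow> q \<in> \<Omega> \<Longrightarrow> dist p q < \<delta> \<Longrightarrow> F q - F p \<le> \<kappa> * dist p q"
proof -
  have "((\<lambda>d. r / sqrt (r\<^sup>2 - d\<^sup>2 / 4)) \<longlongrightarrow> r / sqrt (r\<^sup>2 - 0\<^sup>2 / 4)) (nhds 0)"
    using r_pos by (intro tendsto_intros filterlim_ident) auto
  then have "eventually (\<lambda>d. r / sqrt (r\<^sup>2 - d\<^sup>2 / 4) < \<kappa>) (nhds 0)"
    using \<open>1 < \<kappa>\<close> r_pos by (intro order_tendstoD(2)) auto
  then obtain d where d: "0 < d" "\<And>x. dist x 0 < d \<Longrightarrow> r / sqrt (r\<^sup>2 - x\<^sup>2 / 4) < \<kappa>"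
    unfolding eventually_nhds_metric by blast
  show ?thesis
  proof (rule that[of "min d (2 * r)"])
    fix p q assume pq: "p \<in> \<Omega>" "q \<in> \<Omega>" "dist p q < min d (2 * r)"
    have "F q - F p \<le> r / sqrt (r\<^sup>2 - (dist p q)\<^sup>2 / 4) * dist p q + e" if "0 < e" for e
      using pq that closure_subset by (intro F nearby_chain) auto
    then have "F q - F p \<le> r / sqrt (r\<^sup>2 - (dist p q)\<^sup>2 / 4) * dist p q"
      by (rule field_le_epsilon)
    also have "\<dots> \<le> \<kappa> * dist p q" using d(2)[of "dist p q"] pq by (intro mult_right_mono) auto
    finally show "F q - F p \<le> \<kappa> * dist p q" .
  qed (use d(1) r_pos in auto)
qed

text \<open>
  Divide the curve into \<open>N\<close> parts and replace the division points by nearby points of \<open>\<Omega>\<close>, keeping the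
  end points. On each part the local estimate applies, with a factor \<open>1 + e\<close> and a total displacement
  of at most \<open>e\<close>; then \<open>e\<close> tends to \<open>0\<close>.
\<close>

lemma chain_lipschitz_le_curve:
  assumes F: "\<And>p q l. polygonal_chain \<Omega> p q l \<Longrightarrow> F q - F p \<le> l"
    and "x \<in> \<Omega>" "y \<in> \<Omega>" and link: "joined_by_curve (closure \<Omega>) x y l"
  shows "F y - F x \<le> l"
proof -
  obtain \<gamma> where \<gamma>: "valid_path \<gamma>" "pathstart \<gamma> = x" "pathfinish \<gamma> = y" "path_image \<gamma> \<subseteq> closure \<Omega>"
    and l: "((\<lambda>t. norm (vector_derivative \<gamma> (at t))) has_integral l) {0..1}"
    using link by (auto simp: joined_by_curve_def)
  define v where "v = (\<lambda>t. norm (vector_derivative \<gamma> (at t)))"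
  have iv: "v integrable_on {0..1}" using l by (auto simp: v_def)
  have approx: "F y - F x \<le> (1 + e) * (l + e)" if "0 < e" for e
  proof -
    have "1 < 1 + e" using \<open>0 < e\<close> by simp
    from chain_lipschitz_nearby[of F "1 + e", OF F this]
    obtain \<delta> where \<delta>: "0 < \<delta>"
      "\<And>p q. p \<in> \<Omega> \<Longrightarrow> q \<in> \<Omega> \<Longrightarrow> dist p q < \<delta> \<Longrightarrow> F q - F p \<le> (1 + e) * dist p q"
      by metis
    have "uniformly_continuous_on {0..1} \<gamma>"
      using \<gamma>(1) by (intro compact_uniformly_continuous) (auto dest: valid_path_imp_path simp: path_def)
    then obtain d where d: "0 < d" "\<And>s t. s \<in> {0..1} \<Longrightarrow> t \<in> {0..1} \<Longrightarrow> dist t s < d \<Longrightarrow> dist (\<gamma> t) (\<gamma> s) < \<delta> / 2"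
      using \<delta>(1) unfolding uniformly_continuous_on_def by (metis half_gt_zero)
    obtain N where N: "0 < N" "1 / real N < d"
      using reals_Archimedean[OF d(1)] by (metis inverse_eq_divide zero_less_Suc)
    define \<tau> where "\<tau> = (\<lambda>i. real i / N)"
    have \<tau>: "\<tau> i \<in> {0..1}" if "i \<le> N" for i using that N(1) by (auto simp: \<tau>_def)
    have \<tau>le: "\<tau> i \<le> \<tau> (Suc i)" for i by (auto simp: \<tau>_def divide_right_mono)
    \<comment> \<open>Displacement of the division points: two of them cost at most \<open>e / N\<close> per part.\<close>
    define \<sigma> where "\<sigma> = min (\<delta> / 4) (e / (2 * N))"
    have \<sigma>: "0 < \<sigma>" using \<delta>(1) that N(1) by (auto simp: \<sigma>_def)
    have "\<exists>c\<in>\<Omega>. dist (\<gamma> (\<tau> i)) c < \<sigma> \<and> (i = 0 \<longrightarrow> c = x) \<and> (i = N \<longrightarrow> c = y)" if "i \<le> N" for i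
    proof -
      consider "i = 0" | "i = N" "i \<noteq> 0" | "i \<noteq> 0" "i \<noteq> N" by blast
      then show ?thesis
      proof cases
        case 1
        then show ?thesis using \<gamma>(2) \<open>x \<in> \<Omega>\<close> \<sigma> N(1) by (auto simp: \<tau>_def pathstart_def)
      next
        case 2
        then show ?thesis using \<gamma>(3) \<open>y \<in> \<Omega>\<close> \<sigma> N(1) by (auto simp: \<tau>_def pathfinish_def)
      next
        case 3
        have "\<gamma> (\<tau> i) \<in> closure \<Omega>" using \<gamma>(4) \<tau>[OF that] by (auto simp: path_image_def)
        then obtain c where "c \<in> \<Omega>" "dist c (\<gamma> (\<tau> i)) < \<sigma>" using \<sigma> by (auto simp: closure_approachable)
        then show ?thesis using 3 by (auto simp: dist_commute)
      qed
    qed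
    then obtain c where c: "\<And>i. i \<le> N \<Longrightarrow> c i \<in> \<Omega>" "\<And>i. i \<le> N \<Longrightarrow> dist (\<gamma> (\<tau> i)) (c i) < \<sigma>"
      and ends: "c 0 = x" "c N = y"
      by (metis le0 order_refl)
    have step: "F (c (Suc i)) - F (c i) \<le> (1 + e) * (integral {\<tau> i..\<tau> (Suc i)} v + e / N)" if "Suc i \<le> N" for i
    proof -
      have cc: "dist (c i) (c (Suc i)) \<le> dist (\<gamma> (\<tau> i)) (\<gamma> (\<tau> (Suc i))) + 2 * \<sigma>"
      proof -
        have "dist (c i) (c (Suc i)) \<le> dist (\<gamma> (\<tau> i)) (c i) + dist (\<gamma> (\<tau> i)) (\<gamma> (\<tau> (Suc i)))
            + dist (\<gamma> (\<tau> (Suc i))) (c (Suc i))" by metric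
        then show ?thesis using c(2)[of i] c(2)[of "Suc i"] that by linarith
      qed
      have "dist (\<tau> i) (\<tau> (Suc i)) = 1 / N" using N(1) by (simp add: \<tau>_def dist_real_def field_simps)
      then have "dist (\<gamma> (\<tau> i)) (\<gamma> (\<tau> (Suc i))) < \<delta> / 2" using \<tau> N(2) that by (intro d(2)) auto
      then have "dist (c i) (c (Suc i)) < \<delta>" using cc by (auto simp: \<sigma>_def)
      then have "F (c (Suc i)) - F (c i) \<le> (1 + e) * dist (c i) (c (Suc i))"
        using c(1) that by (intro \<delta>(2)) auto
      also have "dist (c i) (c (Suc i)) \<le> integral {\<tau> i..\<tau> (Suc i)} v + e / N"
      proof -
        have "dist (\<gamma> (\<tau> i)) (\<gamma> (\<tau> (Suc i))) \<le> integral {\<tau> i..\<tau> (Suc i)} v"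
          unfolding v_def using \<tau>[of i] \<tau>[of "Suc i"] \<tau>le[of i] that \<gamma>(1) iv
          by (intro dist_le_integral_speed) (auto simp: v_def)
        moreover have "2 * \<sigma> \<le> e / N" by (auto simp: \<sigma>_def min_def field_simps)
        ultimately show ?thesis using cc by linarith
      qed
      finally show ?thesis using \<open>0 < e\<close> by simp
    qed
    have "F (c i) - F x \<le> (1 + e) * (integral {0..\<tau> i} v + i * (e / N))" if "i \<le> N" for i
      using that
    proof (induction i)
      case 0
      then show ?case by (simp add: ends \<tau>_def)
    next
      case (Suc i)
      have "integral {0..\<tau> i} v + integral {\<tau> i..\<tau> (Suc i)} v = integral {0..\<tau> (Suc i)} v"
        using \<tau>[of i] \<tau>[of "Suc i"] Suc.prems \<tau>le[of i]
        by (intro Henstock_Kurzweil_Integration.integral_combine integrable_on_subinterval[OF iv]) auto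
      then have "(1 + e) * (integral {0..\<tau> (Suc i)} v + Suc i * (e / N)) =
          (1 + e) * (integral {0..\<tau> i} v + i * (e / N)) + (1 + e) * (integral {\<tau> i..\<tau> (Suc i)} v + e / N)"
        by (simp add: algebra_simps add_divide_distrib flip: \<open>_ = integral {0..\<tau> (Suc i)} v\<close>)
      then show ?case using Suc step[OF Suc.prems] by simp
    qed
    from this[of N] show ?thesis
      using N(1) l by (simp add: ends \<tau>_def v_def integral_unique)
  qed
  have "((\<lambda>e. (1 + e) * (l + e)) \<longlongrightarrow> (1 + 0) * (l + 0)) (at_right 0)"
    by (intro tendsto_intros)
  moreover have "eventually (\<lambda>e. F y - F x \<le> (1 + e) * (l + e)) (at_right 0)"
    using eventually_at_right_less by eventually_elim (rule approx)
  ultimately have "F y - F x \<le> (1 + 0) * (l + 0)"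
    by (intro tendsto_lowerbound) auto
  then show ?thesis by simp
qed

end

lemma test_function_chain_le:
  fixes \<Omega> :: "(real ^ 'n::finite) set"
  assumes "open \<Omega>" "\<phi> \<in> test_functions \<Omega> m \<beta>" "polygonal_chain \<Omega> p q l"
  shows "\<phi> q - \<phi> p \<le> l"
  using assms(3)
proof (induction)
  case (extend_chain y l z l')
  have "norm (\<phi> z - \<phi> y) \<le> 1 * norm (z - y)"
  proof (rule differentiable_bound[OF convex_closed_segment])
    fix w assume "w \<in> closed_segment y z"
    then have w: "w \<in> \<Omega>" using extend_chain(2) by blast
    have "smooth_on \<Omega> \<phi>" using assms(2) by (simp add: test_functions_def)
    then have "\<phi> differentiable_on \<Omega>" by (rule smooth_on_differentiable_on)
    then have "\<phi> differentiable (at w)"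
      using w by (simp add: differentiable_on_eq_differentiable_at[OF assms(1)])
    then show "(\<phi> has_derivative (\<lambda>h. grad \<phi> w \<bullet> h)) (at w within closed_segment y z)"
      by (rule has_derivative_at_withinI[OF has_derivative_grad])
    have g: "norm (grad \<phi> w) \<le> 1" using assms(2) w by (auto simp: test_functions_def)
    show "onorm (\<lambda>h. grad \<phi> w \<bullet> h) \<le> 1"
    proof (rule onorm_bound)
      show "norm (grad \<phi> w \<bullet> h) \<le> 1 * norm h" for h
        using Cauchy_Schwarz_ineq2[of "grad \<phi> w" h] mult_right_mono[OF g, of "norm h"] by simp
    qed simp
  qed auto
  then show ?case using extend_chain by (simp add: dist_norm norm_minus_commute)
qed auto

section \<open>Mollification\<close>

definition mollify :: "(real ^ 'n::finite \<Rightarrow> real) \<Rightarrow> real \<Rightarrow> (real ^ 'n \<Rightarrow> real) \<Rightarrow> real ^ 'n \<Rightarrow> real" where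
  "mollify g \<epsilon> f x = (\<integral>z. g z * f (x - \<epsilon> *\<^sub>R z) \<partial>lborel)"

lemma mollify_integrable:
  fixes g :: "real ^ 'n::finite \<Rightarrow> real"
  assumes "smooth_within \<rho> g" "f \<in> borel_measurable borel" "\<And>x. \<bar>f x\<bar> \<le> M"
  shows "integrable lborel (\<lambda>z. g z * f (x - \<epsilon> *\<^sub>R z))"
proof (rule smooth_within_integrable_mult[OF assms(1)])
  show "(\<lambda>z. f (x - \<epsilon> *\<^sub>R z)) \<in> borel_measurable borel"
    using assms(2) by (rule measurable_compose[rotated]) measurable
qed (rule assms(3))

lemma integral_lborel_translate:
  fixes F :: "'a::euclidean_space \<Rightarrow> real"
  assumes "F \<in> borel_measurable borel"
  shows "(\<integral>z. F (z + k) \<partial>lborel) = (\<integral>z. F z \<partial>lborel)"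
proof -
  have "(\<integral>z. F z \<partial>lborel) = (\<integral>z. F z \<partial>distr lborel borel ((+) k))"
    by (simp add: lborel_distr_plus)
  also have "\<dots> = (\<integral>z. F (k + z) \<partial>lborel)"
    using assms by (intro integral_distr) auto
  finally show ?thesis by (simp add: add.commute)
qed

text \<open>
  Moving \<open>x\<close> by \<open>\<epsilon> k\<close> amounts to moving the argument of the kernel by \<open>k\<close>. All differentiations of a
  mollification can thus be performed on the kernel, and \<open>f\<close> need only be bounded and measurable.
\<close>

lemma mollify_shift:
  fixes g :: "real ^ 'n::finite \<Rightarrow> real"
  assumes "smooth_within \<rho> g" "f \<in> borel_measurable borel" "\<And>x. \<bar>f x\<bar> \<le> M" "0 < \<epsilon>"
  shows "integrable lborel (\<lambda>z. g (z + k) * f (x - \<epsilon> *\<^sub>R z))"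
    and "mollify g \<epsilon> f (x + \<epsilon> *\<^sub>R k) = (\<integral>z. g (z + k) * f (x - \<epsilon> *\<^sub>R z) \<partial>lborel)"
proof -
  define F where "F = (\<lambda>z. g z * f (x + \<epsilon> *\<^sub>R k - \<epsilon> *\<^sub>R z))"
  have F: "integrable lborel F" unfolding F_def using assms(1-3) by (rule mollify_integrable)
  then have Fm: "F \<in> borel_measurable borel" by auto
  have shift: "(\<lambda>z. g (z + k) * f (x - \<epsilon> *\<^sub>R z)) = (\<lambda>z. F (z + k))"
    by (simp add: F_def algebra_simps)
  have "integrable (distr lborel borel ((+) k)) F" using F by (simp add: lborel_distr_plus)
  then have "integrable lborel (\<lambda>z. F (k + z))"
    using Fm by (subst (asm) integrable_distr_eq) auto
  then show "integrable lborel (\<lambda>z. g (z + k) * f (x - \<epsilon> *\<^sub>R z))"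
    unfolding shift by (simp add: add.commute)
  show "mollify g \<epsilon> f (x + \<epsilon> *\<^sub>R k) = (\<integral>z. g (z + k) * f (x - \<epsilon> *\<^sub>R z) \<partial>lborel)"
    unfolding shift integral_lborel_translate[OF Fm] by (simp add: mollify_def F_def)
qed

text \<open>
  The gradient is uniformly continuous, being continuous with compact support. Uniformity in \<open>z\<close>
  is what allows differentiating under the integral sign.
\<close>

lemma uniform_linearization:
  fixes g :: "real ^ 'n::finite \<Rightarrow> real"
  assumes "smooth_within \<rho> g" "0 < \<eta>"
  obtains \<delta> where "0 < \<delta>" "\<delta> \<le> 1"
    "\<And>z k. norm k \<le> \<delta> \<Longrightarrow> \<bar>g (z + k) - g z - grad g z \<bullet> k\<bar> \<le> \<eta> * norm k"
proof -
  have diff: "(g has_derivative (\<lambda>h. grad g z \<bullet> h)) (at z)" for z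
    using assms(1) by (intro has_derivative_grad)
      (auto simp: smooth_within_def differentiable_on_def dest!: smooth_on_differentiable_on)
  have cont: "continuous_on UNIV (grad g)"
    unfolding grad_def
    using assms(1) smooth_within_continuous smooth_within_pderiv_dir
    by (intro continuous_on_vec_lambda) blast
  have "uniformly_continuous_on (cball 0 (\<rho> + 2)) (grad g)"
    by (intro compact_uniformly_continuous continuous_on_subset[OF cont]) auto
  then obtain d where d: "0 < d" "\<And>x y. x \<in> cball 0 (\<rho> + 2) \<Longrightarrow> y \<in> cball 0 (\<rho> + 2) \<Longrightarrow>
      dist y x < d \<Longrightarrow> dist (grad g y) (grad g x) < \<eta>"
    using assms(2) unfolding uniformly_continuous_on_def by metis
  (* Displacements are at most 1, so k moves no point outside the larger ball into the support. *)
  define \<delta> where "\<delta> = min 1 (d / 2)"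
  show ?thesis
  proof (rule that[of \<delta>])
    fix z k :: "real ^ 'n" assume k: "norm k \<le> \<delta>"
    show "\<bar>g (z + k) - g z - grad g z \<bullet> k\<bar> \<le> \<eta> * norm k"
    proof (cases "z \<in> cball 0 (\<rho> + 1)")
      case True
      have "norm (g (z + k) - g z - grad g z \<bullet> ((z + k) - z)) \<le> norm ((z + k) - z) * \<eta>"
      proof (rule differentiable_bound_linearization[where S = "cball z \<delta>" and f' = "\<lambda>y h. grad g y \<bullet> h"])
        fix y assume y: "y \<in> cball z \<delta>"
        show "(g has_derivative (\<lambda>h. grad g y \<bullet> h)) (at y within cball z \<delta>)"
          using diff has_derivative_at_withinI by blast
        have "dist y z < d" "norm y \<le> norm z + dist z y" "dist z y \<le> 1"
          using y d(1) norm_triangle_sub[of y z]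
          by (auto simp: \<delta>_def dist_commute dist_norm norm_minus_commute)
        then have "dist (grad g y) (grad g z) < \<eta>" using True by (intro d) auto
        then have "norm (grad g y - grad g z) \<le> \<eta>" by (simp add: dist_norm)
        then have "norm ((grad g y - grad g z) \<bullet> i) \<le> \<eta> * norm i" for i
          using Cauchy_Schwarz_ineq2[of "grad g y - grad g z" i]
            mult_right_mono[of "norm (grad g y - grad g z)" \<eta> "norm i"] by simp
        then show "onorm ((\<lambda>h. grad g y \<bullet> h) - (\<lambda>h. grad g z \<bullet> h)) \<le> \<eta>"
          using assms(2) by (intro onorm_bound) (auto simp: inner_diff_left)
      next
        fix t :: real assume "t \<in> {0..1}"
        then have "t * norm k \<le> 1 * norm k" by (intro mult_right_mono) auto
        then show "z + t *\<^sub>R (z + k - z) \<in> cball z \<delta>"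
          using k \<open>t \<in> {0..1}\<close> by (simp add: dist_norm)
      qed (use d(1) in \<open>auto simp: \<delta>_def\<close>)
      then show ?thesis by (simp add: mult.commute)
    next
      case False
      have "norm z \<le> norm (z + k) + norm k" using norm_triangle_ineq4[of "z + k" k] by simp
      then have "z \<notin> cball 0 \<rho>" "z + k \<notin> cball 0 \<rho>" using False k by (auto simp: \<delta>_def)
      moreover have "grad g z = 0"
        using False assms(1) \<open>z \<notin> cball 0 \<rho>\<close> smooth_within_pderiv_dir[OF assms(1)]
        by (auto simp: grad_def smooth_within_def vec_eq_iff)
      ultimately show ?thesis using assms by (auto simp: smooth_within_def)
    qed
  qed (use d in \<open>auto simp: \<delta>_def\<close>)
qed

lemma mollify_has_derivative:
  fixes g :: "real ^ 'n::finite \<Rightarrow> real"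
  assumes g: "smooth_within \<rho> g" and f: "f \<in> borel_measurable borel" "\<And>x. \<bar>f x\<bar> \<le> M" and "0 < \<epsilon>"
  shows "((mollify g \<epsilon> f) has_derivative
     (\<lambda>h. (\<chi> a. mollify (pderiv_dir a g) \<epsilon> f x / \<epsilon>) \<bullet> h)) (at x)"
proof -
  define w where "w = (\<chi> a. mollify (pderiv_dir a g) \<epsilon> f x / \<epsilon>)"
  have M: "0 \<le> M" using f(2)[of 0] by linarith
  have w: "integrable lborel (\<lambda>z. (grad g z \<bullet> k) * f (x - \<epsilon> *\<^sub>R z))"
    "(\<integral>z. (grad g z \<bullet> k) * f (x - \<epsilon> *\<^sub>R z) \<partial>lborel) = w \<bullet> (\<epsilon> *\<^sub>R k)" for k
  proof -
    have i: "integrable lborel (\<lambda>z. pderiv_dir a g z * f (x - \<epsilon> *\<^sub>R z))" for a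
      using smooth_within_pderiv_dir[OF g] f by (rule mollify_integrable)
    have eq: "(\<lambda>z. (grad g z \<bullet> k) * f (x - \<epsilon> *\<^sub>R z)) =
        (\<lambda>z. \<Sum>a\<in>UNIV. k $ a * (pderiv_dir a g z * f (x - \<epsilon> *\<^sub>R z)))"
      by (simp add: inner_vec_def grad_def sum_distrib_left algebra_simps)
    show "integrable lborel (\<lambda>z. (grad g z \<bullet> k) * f (x - \<epsilon> *\<^sub>R z))"
      unfolding eq by (intro Bochner_Integration.integrable_sum integrable_mult_right i)
    have "(\<integral>z. (grad g z \<bullet> k) * f (x - \<epsilon> *\<^sub>R z) \<partial>lborel) =
        (\<Sum>a\<in>UNIV. k $ a * mollify (pderiv_dir a g) \<epsilon> f x)"
      unfolding eq mollify_def using i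
      by (subst Bochner_Integration.integral_sum) auto
    also have "\<dots> = w \<bullet> (\<epsilon> *\<^sub>R k)"
      using \<open>0 < \<epsilon>\<close> by (simp add: w_def inner_vec_def mult.commute)
    finally show "(\<integral>z. (grad g z \<bullet> k) * f (x - \<epsilon> *\<^sub>R z) \<partial>lborel) = w \<bullet> (\<epsilon> *\<^sub>R k)" .
  qed
  define V where "V = measure lborel (cball (0::real^'n) (\<rho> + 1))"
  have V: "0 \<le> V" by (simp add: V_def)
  have "\<exists>d>0. \<forall>y. norm (y - x) < d \<longrightarrow>
      norm (mollify g \<epsilon> f y - mollify g \<epsilon> f x - w \<bullet> (y - x)) \<le> e * norm (y - x)" if "0 < e" for e
  proof -
    define \<eta> where "\<eta> = e * \<epsilon> / (M * V + 1)"
    have MV: "0 \<le> M * V" using M V by simp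
    have "0 < \<eta>" using that \<open>0 < \<epsilon>\<close> MV by (auto simp: \<eta>_def intro!: divide_pos_pos)
    then obtain \<delta> where \<delta>: "0 < \<delta>" "\<delta> \<le> 1"
      "\<And>z k. norm k \<le> \<delta> \<Longrightarrow> \<bar>g (z + k) - g z - grad g z \<bullet> k\<bar> \<le> \<eta> * norm k"
      using uniform_linearization[OF g] by metis
    have "norm (mollify g \<epsilon> f y - mollify g \<epsilon> f x - w \<bullet> (y - x)) \<le> e * norm (y - x)"
      if y: "norm (y - x) < \<delta> * \<epsilon>" for y
    proof -
      define k where "k = (1 / \<epsilon>) *\<^sub>R (y - x)"
      have yk: "y = x + \<epsilon> *\<^sub>R k" "norm (y - x) = \<epsilon> * norm k" using \<open>0 < \<epsilon>\<close> by (auto simp: k_def)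
      then have k: "norm k \<le> \<delta>" using y \<open>0 < \<epsilon>\<close> by (simp add: mult.commute)
      let ?E = "\<lambda>z. (g (z + k) - g z - grad g z \<bullet> k) * f (x - \<epsilon> *\<^sub>R z)"
      have eq: "?E = (\<lambda>z. g (z + k) * f (x - \<epsilon> *\<^sub>R z) - g z * f (x - \<epsilon> *\<^sub>R z)
          - (grad g z \<bullet> k) * f (x - \<epsilon> *\<^sub>R z))" by (simp add: algebra_simps)
      note ints = mollify_shift(1)[OF g f \<open>0 < \<epsilon>\<close>, of k x] mollify_integrable[OF g f, of x \<epsilon>] w(1)[of k]
      have iE: "integrable lborel ?E" unfolding eq using ints by auto
      have e1: "mollify g \<epsilon> f y - mollify g \<epsilon> f x - w \<bullet> (y - x) = (\<integral>z. ?E z \<partial>lborel)"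
        unfolding eq using ints
        by (simp add: yk(1) mollify_shift(2)[OF g f \<open>0 < \<epsilon>\<close>, of x k] w(2)) (simp add: mollify_def)
      have e2: "norm (\<integral>z. ?E z \<partial>lborel) \<le> (\<integral>z. norm (?E z) \<partial>lborel)" by simp
      have e3: "(\<integral>z. norm (?E z) \<partial>lborel)
          \<le> (\<integral>z. \<eta> * norm k * M * indicator (cball (0 :: real ^ 'n) (\<rho> + 1)) z \<partial>lborel)"
      proof (rule Bochner_Integration.integral_mono)
        show "integrable lborel (\<lambda>z. norm (?E z))" using iE by (rule integrable_norm)
        show "integrable lborel (\<lambda>z. \<eta> * norm k * M * indicator (cball (0::real^'n) (\<rho> + 1)) z)"
          using emeasure_lborel_cball_finite[of "0 :: real ^ 'n" "\<rho> + 1"]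
          by (intro integrable_mult_right integrable_real_indicator) auto
        fix z
        show "norm (?E z) \<le> \<eta> * norm k * M * indicator (cball (0 :: real ^ 'n) (\<rho> + 1)) z"
        proof (cases "z \<in> cball 0 (\<rho> + 1)")
          case True
          then show ?thesis using \<delta>(3)[OF k, of z] f(2)[of "x - \<epsilon> *\<^sub>R z"] \<open>0 < \<eta>\<close>
            by (auto simp: abs_mult intro!: mult_mono)
        next
          case False
          have "norm z \<le> norm (z + k) + norm k" using norm_triangle_ineq4[of "z + k" k] by simp
          then have "z \<notin> cball 0 \<rho>" "z + k \<notin> cball 0 \<rho>" using False k \<delta>(2) by auto
          moreover have "grad g z = 0"
            using False \<open>z \<notin> cball 0 \<rho>\<close> smooth_within_pderiv_dir[OF g]
            by (auto simp: grad_def smooth_within_def vec_eq_iff)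
          ultimately show ?thesis using g False by (simp add: smooth_within_def)
        qed
      qed
      have e4: "(\<integral>z. \<eta> * norm k * M * indicator (cball (0 :: real ^ 'n) (\<rho> + 1)) z \<partial>lborel)
          = \<eta> * norm k * M * V"
        by (simp add: V_def)
      have e5: "\<eta> * norm k * M * V \<le> e * norm (y - x)"
      proof -
        have "\<eta> * (M * V) \<le> \<eta> * (M * V + 1)" using \<open>0 < \<eta>\<close> by (intro mult_left_mono) auto
        also have "\<dots> = e * \<epsilon>" using MV by (simp add: \<eta>_def)
        finally have "\<eta> * (M * V) * norm k \<le> e * \<epsilon> * norm k" by (intro mult_right_mono) auto
        then show ?thesis by (simp add: yk(2) algebra_simps)
      qed
      show ?thesis
        unfolding e1 by (rule order_trans[OF e2 order_trans[OF e3]]) (simp only: e4 e5)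
    qed
    then show ?thesis using \<delta>(1) \<open>0 < \<epsilon>\<close> by (intro exI[of _ "\<delta> * \<epsilon>"]) auto
  qed
  then have "(mollify g \<epsilon> f has_derivative (\<lambda>h. w \<bullet> h)) (at x)"
    unfolding has_derivative_at_alt using bounded_linear_inner_right by blast
  then show ?thesis by (simp add: w_def)
qed

lemma scaled_mollify_has_derivative:
  fixes g :: "real ^ 'n::finite \<Rightarrow> real"
  assumes g: "smooth_within \<rho> g" and f: "f \<in> borel_measurable borel" "\<And>x. \<bar>f x\<bar> \<le> M" and "0 < \<epsilon>"
  shows "(\<lambda>x. c * mollify g \<epsilon> f x) differentiable (at x)"
    and "pderiv_dir a (\<lambda>x. c * mollify g \<epsilon> f x) = (\<lambda>x. c / \<epsilon> * mollify (pderiv_dir a g) \<epsilon> f x)"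
proof -
  have D: "((\<lambda>x. c * mollify g \<epsilon> f x) has_derivative
      (\<lambda>h. c * ((\<chi> a. mollify (pderiv_dir a g) \<epsilon> f x / \<epsilon>) \<bullet> h))) (at x)" for x
    by (intro derivative_intros mollify_has_derivative[OF assms])
  then show "(\<lambda>x. c * mollify g \<epsilon> f x) differentiable (at x)"
    by (auto simp: differentiable_def)
  show "pderiv_dir a (\<lambda>x. c * mollify g \<epsilon> f x) = (\<lambda>x. c / \<epsilon> * mollify (pderiv_dir a g) \<epsilon> f x)"
    by (rule ext) (simp add: has_derivative_pderiv_dir[OF D] inner_axis)
qed

lemma smooth_on_scaled_mollify:
  fixes g :: "real ^ 'n::finite \<Rightarrow> real"
  assumes g: "smooth_within \<rho> g" and f: "f \<in> borel_measurable borel" "\<And>x. \<bar>f x\<bar> \<le> M" and "0 < \<epsilon>"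
  shows "smooth_on S (\<lambda>x. c * mollify g \<epsilon> f x)"
proof -
  have diff: "(\<lambda>x. c * mollify g \<epsilon> f x) differentiable_on S" if "smooth_within \<rho> g" for c g
    using scaled_mollify_has_derivative(1)[OF that f \<open>0 < \<epsilon>\<close>]
    by (auto simp: differentiable_on_def intro: differentiable_at_withinI)
  have "Ck_on k UNIV S (\<lambda>x. c * mollify g \<epsilon> f x)" for k
    using g
  proof (induction k arbitrary: c g)
    case 0
    then show ?case using differentiable_imp_continuous_on[OF diff] by simp
  next
    case (Suc k)
    have "Ck_on k UNIV S (pderiv_dir a (\<lambda>x. c * mollify g \<epsilon> f x))" for a
      unfolding scaled_mollify_has_derivative(2)[OF Suc.prems f \<open>0 < \<epsilon>\<close>]
      by (rule Suc.IH[OF smooth_within_pderiv_dir[OF Suc.prems]])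
    then show ?case using diff[OF Suc.prems] by simp
  qed
  then show ?thesis by (simp add: smooth_on_def)
qed

lemma smooth_within_funpow: "smooth_within \<rho> g \<Longrightarrow> smooth_within \<rho> ((pderiv_dir a ^^ j) g)"
  by (induction j) (auto intro: smooth_within_pderiv_dir)

lemma smooth_within_foldr:
  "smooth_within \<rho> g \<Longrightarrow> smooth_within \<rho> (foldr (\<lambda>a. pderiv_dir a ^^ i a) as g)"
  by (induction as) (auto intro: smooth_within_funpow)

lemma smooth_within_mderiv: "smooth_within \<rho> g \<Longrightarrow> smooth_within \<rho> (mderiv i g)"
  by (simp add: mderiv_def smooth_within_foldr)

lemma coord_list: "distinct (coord_list :: 'n::finite list)" "set (coord_list :: 'n list) = UNIV"
  using someI_ex[OF finite_distinct_list[OF finite, of "UNIV :: 'n set"]]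
  unfolding coord_list_def by (auto simp: conj_commute)

lemma mderiv_scaled_mollify:
  fixes g :: "real ^ 'n::finite \<Rightarrow> real"
  assumes g: "smooth_within \<rho> g" and f: "f \<in> borel_measurable borel" "\<And>x. \<bar>f x\<bar> \<le> M" and "0 < \<epsilon>"
  shows "mderiv i (\<lambda>x. c * mollify g \<epsilon> f x) =
    (\<lambda>x. c / \<epsilon> ^ mi_order i * mollify (mderiv i g) \<epsilon> f x)"
proof -
  have pow: "(pderiv_dir a ^^ j) (\<lambda>x. c * mollify g \<epsilon> f x) =
      (\<lambda>x. c / \<epsilon> ^ j * mollify ((pderiv_dir a ^^ j) g) \<epsilon> f x)" if "smooth_within \<rho> g" for a j c g
  proof (induction j)
    case (Suc j)
    have "(pderiv_dir a ^^ Suc j) (\<lambda>x. c * mollify g \<epsilon> f x) =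
        pderiv_dir a (\<lambda>x. c / \<epsilon> ^ j * mollify ((pderiv_dir a ^^ j) g) \<epsilon> f x)"
      by (simp only: funpow.simps o_apply Suc.IH)
    also have "\<dots> = (\<lambda>x. c / \<epsilon> ^ j / \<epsilon> * mollify ((pderiv_dir a ^^ Suc j) g) \<epsilon> f x)"
      unfolding scaled_mollify_has_derivative(2)[OF smooth_within_funpow[OF that] f \<open>0 < \<epsilon>\<close>] by simp
    finally show ?case by (simp add: mult.commute)
  qed simp
  have "foldr (\<lambda>a. pderiv_dir a ^^ i a) as (\<lambda>x. c * mollify g \<epsilon> f x) =
      (\<lambda>x. c / \<epsilon> ^ sum_list (map i as) * mollify (foldr (\<lambda>a. pderiv_dir a ^^ i a) as g) \<epsilon> f x)" for as
  proof (induction as)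
    case (Cons a as)
    show ?case
      by (simp only: foldr.simps o_apply Cons.IH pow[OF smooth_within_foldr[OF g]])
        (simp add: power_add mult.commute)
  qed simp
  moreover have "sum_list (map i (coord_list :: 'n list)) = mi_order i"
    using coord_list[where 'n = 'n] by (simp add: sum_list_distinct_conv_sum_set mi_order_def)
  ultimately show ?thesis by (simp add: mderiv_def)
qed

text \<open>
  The outermost of the partial derivatives in \<open>mderiv i\<close> is split off, so no two partial derivatives have to be
  exchanged. It is the one that falls on the Lipschitz function.
\<close>

lemma mderiv_peel:
  fixes i :: "'n::finite \<Rightarrow> nat"
  assumes "mi_order i = Suc k"
  obtains a j where "\<And>f. mderiv i f = pderiv_dir a (mderiv j f)" "mi_order j = k"
proof -
  have peel: "\<exists>a\<in>set as. i a > 0 \<and> (\<forall>f. foldr (\<lambda>a. pderiv_dir a ^^ i a) as f =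
      pderiv_dir a (foldr (\<lambda>b. pderiv_dir b ^^ (i(a := i a - 1)) b) as f))"
    if "distinct as" "\<exists>a\<in>set as. i a > 0" for as :: "'n list"
    using that
  proof (induction as)
    case (Cons b as)
    show ?case
    proof (cases "i b")
      case 0
      then have "\<exists>a\<in>set as. i a > 0" using Cons.prems(2) by auto
      then obtain a where a: "a \<in> set as" "i a > 0" "\<And>f. foldr (\<lambda>a. pderiv_dir a ^^ i a) as f =
          pderiv_dir a (foldr (\<lambda>b. pderiv_dir b ^^ (i(a := i a - 1)) b) as f)"
        using Cons by auto
      then show ?thesis using 0 Cons.prems(1) by (intro bexI[of _ a]) auto
    next
      case (Suc l)
      have "foldr (\<lambda>a. pderiv_dir a ^^ i a) as f =
          foldr (\<lambda>a. pderiv_dir a ^^ (i(b := l)) a) as f" for f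
        using Cons.prems(1) by (intro foldr_cong) auto
      then show ?thesis using Suc by (intro bexI[of _ b]) auto
    qed
  qed auto
  have "\<exists>a\<in>set (coord_list :: 'n list). i a > 0"
  proof (rule ccontr)
    assume "\<not> ?thesis"
    then have "\<forall>a. i a = 0" by (simp add: coord_list(2))
    then show False using assms by (simp add: mi_order_def)
  qed
  from peel[OF coord_list(1) this] obtain a where a: "i a > 0"
    "\<And>f. mderiv i f = pderiv_dir a (mderiv (i(a := i a - 1)) f)"
    by (auto simp: mderiv_def)
  have "mi_order i = i a + (\<Sum>b\<in>UNIV - {a}. i b)"
    "mi_order (i(a := i a - 1)) = (i a - 1) + (\<Sum>b\<in>UNIV - {a}. i b)"
    unfolding mi_order_def by (simp_all add: sum.remove[of UNIV a])
  then have "mi_order (i(a := i a - 1)) = k" using a(1) assms by simp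
  then show ?thesis using that a(2) by blast
qed

lemma locally_lipschitz_grad_le:
  fixes F :: "real ^ 'n::finite \<Rightarrow> real"
  assumes "F differentiable (at x)" "0 < \<delta>"
    and "\<And>y. norm (y - x) < \<delta> \<Longrightarrow> \<bar>F y - F x\<bar> \<le> B * norm (y - x)"
  shows "norm (grad F x) \<le> B"
proof -
  define v where "v = grad F x"
  have D: "(F has_derivative (\<lambda>h. v \<bullet> h)) (at x)"
    unfolding v_def using assms(1) by (rule has_derivative_grad)
  \<comment> \<open>Compare the increment of \<open>F\<close> in the direction of its gradient \<open>v\<close> with the linear one.\<close>
  have "norm v \<le> B + e" if e: "0 < e" for e
  proof (cases "v = 0")
    case True
    obtain u :: "real ^ 'n" where u: "norm u = \<delta> / 2"
      using vector_choose_size[of "\<delta> / 2"] assms(2) by auto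
    have "0 \<le> B * (\<delta> / 2)" using assms(3)[of "x + u"] u assms(2) by auto
    then have "0 \<le> B" using assms(2) by (simp add: zero_le_mult_iff)
    then show ?thesis using True e by simp
  next
    case False
    obtain d where d: "0 < d" "\<And>y. norm (y - x) < d \<Longrightarrow>
        norm (F y - F x - v \<bullet> (y - x)) \<le> e * norm (y - x)"
      using D e unfolding has_derivative_at_alt by blast
    define s where "s = min d \<delta> / (2 * norm v)"
    have s: "0 < s" "s * norm v < d" "s * norm v < \<delta>"
      using d(1) assms(2) False by (auto simp: s_def)
    define y where "y = x + s *\<^sub>R v"
    have y: "y - x = s *\<^sub>R v" "norm (y - x) = s * norm v" using s(1) by (auto simp: y_def)
    have "v \<bullet> (y - x) \<le> (B + e) * norm (y - x)"
      using d(2)[of y] assms(3)[of y] s y(2) by (simp add: distrib_right) 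
    then have "(s * norm v) * norm v \<le> (s * norm v) * (B + e)"
      using s(1) by (simp add: y power2_norm_eq_inner[symmetric] power2_eq_square algebra_simps)
    then show ?thesis using s(1) False by simp
  qed
  then show ?thesis unfolding v_def by (rule field_le_epsilon)
qed

text \<open>
  If the kernel is supported in a ball of radius \<open>\<rho> < 1\<close>, then for \<open>y\<close> near \<open>x\<close> the averages at
  \<open>x\<close> and at \<open>y\<close> see only values of \<open>f\<close> on \<open>ball x \<epsilon>\<close>.
\<close>

lemma mollify_locally_lipschitz:
  fixes g :: "real ^ 'n::finite \<Rightarrow> real"
  assumes g: "smooth_within \<rho> g" and f: "f \<in> borel_measurable borel" "\<And>x. \<bar>f x\<bar> \<le> M" and "0 < \<epsilon>"
    and L: "\<And>u v. u \<in> ball x \<epsilon> \<Longrightarrow> v \<in> ball x \<epsilon> \<Longrightarrow> \<bar>f u - f v\<bar> \<le> L * dist u v"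
    and y: "norm (y - x) < \<epsilon> * (1 - \<rho>)"
  shows "\<bar>mollify g \<epsilon> f y - mollify g \<epsilon> f x\<bar> \<le> L * (\<integral>z. \<bar>g z\<bar> \<partial>lborel) * norm (y - x)"
proof -
  note ints = mollify_integrable[OF g f, of y \<epsilon>] mollify_integrable[OF g f, of x \<epsilon>]
  have ig: "integrable lborel g"
    using smooth_within_integrable_mult[OF g, of "\<lambda>_. 1" 1] by simp
  have "mollify g \<epsilon> f y - mollify g \<epsilon> f x =
      (\<integral>z. g z * f (y - \<epsilon> *\<^sub>R z) - g z * f (x - \<epsilon> *\<^sub>R z) \<partial>lborel)"
    unfolding mollify_def using ints by simp
  also have "\<bar>\<dots>\<bar> \<le> (\<integral>z. \<bar>g z * f (y - \<epsilon> *\<^sub>R z) - g z * f (x - \<epsilon> *\<^sub>R z)\<bar> \<partial>lborel)"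
    by (rule integral_abs_bound)
  also have "\<dots> \<le> (\<integral>z. L * norm (y - x) * \<bar>g z\<bar> \<partial>lborel)"
  proof (rule Bochner_Integration.integral_mono)
    fix z
    show "\<bar>g z * f (y - \<epsilon> *\<^sub>R z) - g z * f (x - \<epsilon> *\<^sub>R z)\<bar> \<le> L * norm (y - x) * \<bar>g z\<bar>"
    proof (cases "z \<in> cball 0 \<rho>")
      case True
      then have z: "\<epsilon> * norm z \<le> \<epsilon> * \<rho>" using \<open>0 < \<epsilon>\<close> by simp
      have "norm (y - x - \<epsilon> *\<^sub>R z) \<le> norm (y - x) + norm (\<epsilon> *\<^sub>R z)" by (rule norm_triangle_ineq4)
      moreover have norm_z: "norm (\<epsilon> *\<^sub>R z) = \<epsilon> * norm z" using \<open>0 < \<epsilon>\<close> by simp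
      moreover have y': "norm (y - x) < \<epsilon> - \<epsilon> * \<rho>" using y by (simp add: right_diff_distrib)
      ultimately have "norm (y - x - \<epsilon> *\<^sub>R z) < \<epsilon>" using z by linarith
      moreover have "norm (\<epsilon> *\<^sub>R z) < \<epsilon>"
        using z y' norm_z norm_ge_zero[of "y - x"] by linarith
      ultimately have "\<bar>f (y - \<epsilon> *\<^sub>R z) - f (x - \<epsilon> *\<^sub>R z)\<bar> \<le> L * dist (y - \<epsilon> *\<^sub>R z) (x - \<epsilon> *\<^sub>R z)"
        by (intro L) (auto simp: dist_norm norm_minus_commute algebra_simps)
      also have "dist (y - \<epsilon> *\<^sub>R z) (x - \<epsilon> *\<^sub>R z) = norm (y - x)" by (simp add: dist_norm)
      finally have "\<bar>g z\<bar> * \<bar>f (y - \<epsilon> *\<^sub>R z) - f (x - \<epsilon> *\<^sub>R z)\<bar> \<le> \<bar>g z\<bar> * (L * norm (y - x))"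
        by (intro mult_left_mono) auto
      then show ?thesis by (simp add: right_diff_distrib[symmetric] abs_mult mult.commute)
    next
      case False
      then have "g z = 0" using g by (auto simp: smooth_within_def)
      then show ?thesis by simp
    qed
  qed (use ints ig in auto)
  also have "\<dots> = L * (\<integral>z. \<bar>g z\<bar> \<partial>lborel) * norm (y - x)" by simp
  finally show ?thesis .
qed

section \<open>Existence of mollifiers and bounds by their constants\<close>

text \<open>
  The support is a compact subset of the open unit ball, so it keeps a positive distance from the sphere.
\<close>

lemma mollifier_smooth_within:
  fixes k :: "real ^ 'n::finite \<Rightarrow> real"
  assumes "mollifier k"
  obtains \<rho> where "0 \<le> \<rho>" "\<rho> < 1" "smooth_within \<rho> k"
proof -
  let ?S = "closure {x. k x \<noteq> 0}"
  have S: "?S \<subseteq> ball 0 1" using assms by (simp add: mollifier_def)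
  then have "compact ?S" by (auto simp: compact_eq_bounded_closed intro: bounded_subset[OF bounded_ball])
  have sm: "smooth_on UNIV k" using assms by (simp add: mollifier_def)
  show ?thesis
  proof (cases "?S = {}")
    case True
    then have "\<forall>x. k x = 0" by simp
    then show ?thesis using that[of 0] sm by (simp add: smooth_within_def)
  next
    case False
    obtain s where s: "s \<in> ?S" "\<And>z. z \<in> ?S \<Longrightarrow> norm z \<le> norm s"
      using continuous_attains_sup[OF \<open>compact ?S\<close> False continuous_on_norm[OF continuous_on_id]] by auto
    have "k x = 0" if "x \<notin> cball 0 (norm s)" for x
      using that s(2)[of x] closure_subset[of "{x. k x \<noteq> 0}"] by auto
    then show ?thesis using that[of "norm s"] s(1) S sm by (auto simp: smooth_within_def)
  qed
qed

lemma finite_multi_indices: "finite {j :: 'n::finite \<Rightarrow> nat. mi_order j \<le> k}"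
proof -
  have "j a \<le> mi_order j" for j :: "'n \<Rightarrow> nat" and a
    unfolding mi_order_def by (rule member_le_sum) auto
  then have "{j :: 'n \<Rightarrow> nat. mi_order j \<le> k} \<subseteq> (UNIV :: 'n set) \<rightarrow>\<^sub>E {..k}"
    by (intro subsetI PiE_I) (auto intro: order_trans)
  then show ?thesis
    by (rule finite_subset) (rule finite_PiE, rule finite, rule finite_atMost)
qed

lemma mollifier_K_bdd:
  "bdd_above (insert 0 {(LINT x:ball 0 1|lborel. \<bar>mderiv j k x\<bar>) powr (1 / real (mi_order j)) | j.
     1 \<le> mi_order j \<and> mi_order j \<le> m - 1})" (is "bdd_above (insert 0 ?A)")
proof -
  have "?A \<subseteq> (\<lambda>j. (LINT x:ball 0 1|lborel. \<bar>mderiv j k x\<bar>) powr (1 / real (mi_order j))) `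
      {j. mi_order j \<le> m - 1}" by auto
  then have "finite ?A" by (rule finite_subset) (intro finite_imageI finite_multi_indices)
  then show ?thesis by (intro bdd_above_finite finite.insertI)
qed

lemma mollifier_K_nonneg: "0 \<le> mollifier_K m k"
  unfolding mollifier_K_def by (rule cSup_upper, rule insertI1, rule mollifier_K_bdd)

text \<open>
  The definition of \<open>mollifier_K\<close> solved for the integral.
\<close>

lemma integral_mderiv_mollifier_le:
  fixes k :: "real ^ 'n::finite \<Rightarrow> real"
  assumes "mollifier k" "mollifier_K m k \<le> K" "1 \<le> mi_order j" "mi_order j \<le> m - 1"
  shows "(\<integral>z. \<bar>mderiv j k z\<bar> \<partial>lborel) \<le> K ^ mi_order j"
proof -
  obtain \<rho> where \<rho>: "0 \<le> \<rho>" "\<rho> < 1" "smooth_within \<rho> k" using mollifier_smooth_within[OF assms(1)] .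
  define I where "I = (\<integral>z. \<bar>mderiv j k z\<bar> \<partial>lborel)"
  have "(\<lambda>z. indicator (ball 0 1) z *\<^sub>R \<bar>mderiv j k z\<bar>) = (\<lambda>z. \<bar>mderiv j k z\<bar>)"
    using smooth_within_mderiv[OF \<rho>(3), of j] \<rho>(2)
    by (intro ext) (auto simp: smooth_within_def indicator_def)
  then have I: "(LINT x:ball 0 1|lborel. \<bar>mderiv j k x\<bar>) = I"
    by (simp only: set_lebesgue_integral_def I_def)
  have "I powr (1 / real (mi_order j)) \<le> mollifier_K m k"
    unfolding mollifier_K_def I[symmetric]
    by (rule cSup_upper, rule insertI2, use assms(3,4) in blast, rule mollifier_K_bdd)
  then have "(I powr (1 / real (mi_order j))) ^ mi_order j \<le> K ^ mi_order j"
    using assms by (intro power_mono) auto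
  moreover have "0 \<le> I" by (simp add: I_def)
  then have "(I powr (1 / real (mi_order j))) ^ mi_order j = I"
    using assms(3) by (cases "I = 0") (auto simp: powr_realpow[symmetric] powr_powr)
  ultimately show ?thesis by (simp add: I_def)
qed

text \<open>
  The classical functions with all derivatives \<open>0\<close> at \<open>0\<close>. The polynomial factor makes the
  class closed under differentiation, so that smoothness needs only one derivative to be computed.
\<close>

definition flat :: "real poly \<Rightarrow> real \<Rightarrow> real" where
  "flat p t = (if t \<le> 0 then 0 else poly p (1 / t) * exp (- (1 / t)))"

definition flat_deriv :: "real poly \<Rightarrow> real poly" where
  "flat_deriv p = [:0, 0, 1:] * (p - pderiv p)"

lemma flat_tendsto_0: "(flat p \<longlongrightarrow> 0) (at_right 0)"
proof -
  have "((\<lambda>s. \<Sum>i\<le>degree p. coeff p i * (s ^ i / exp s)) \<longlongrightarrow> (\<Sum>i\<le>degree p. coeff p i * 0)) at_top"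
    by (intro tendsto_intros tendsto_power_div_exp_0)
  then have "((\<lambda>s. poly p s * exp (- s)) \<longlongrightarrow> 0) at_top"
    by (simp add: poly_altdef sum_distrib_right exp_minus divide_inverse mult.assoc)
  moreover have "eventually (\<lambda>s. poly p s * exp (- s) = flat p (inverse s)) at_top"
    using eventually_gt_at_top[of "0::real"]
    by eventually_elim (simp add: flat_def inverse_eq_divide)
  ultimately have "((\<lambda>s. flat p (inverse s)) \<longlongrightarrow> 0) at_top"
    by (rule Lim_transform_eventually)
  then show ?thesis by (simp add: filterlim_at_right_to_top)
qed

lemma flat_has_derivative: "(flat p has_real_derivative flat (flat_deriv p) t) (at t)"
proof -
  consider "t < 0" | "t = 0" | "t > 0" by linarith
  then show ?thesis
  proof cases
    case 1
    have "((\<lambda>_. 0) has_real_derivative 0) (at t)" by simp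
    moreover have "eventually (\<lambda>s. s \<in> {..<0}) (nhds t)"
      using 1 by (intro eventually_nhds_in_open) auto
    then have "eventually (\<lambda>s. 0 = flat p s) (nhds t)"
      by eventually_elim (simp add: flat_def)
    ultimately have "(flat p has_real_derivative 0) (at t)"
      by (subst DERIV_cong_ev[OF HOL.refl _ HOL.refl, of _ "\<lambda>_. 0"]) (auto elim: eventually_mono)
    then show ?thesis using 1 by (simp add: flat_def)
  next
    case 2
    have "((\<lambda>h. (flat p (0 + h) - flat p 0) / h) \<longlongrightarrow> 0) (at_right 0)"
    proof (rule Lim_transform_eventually[OF flat_tendsto_0[of "[:0, 1:] * p"]])
      show "eventually (\<lambda>h. flat ([:0, 1:] * p) h = (flat p (0 + h) - flat p 0) / h) (at_right 0)"
        using eventually_at_right_less by eventually_elim (simp add: flat_def)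
    qed
    moreover have "((\<lambda>h. (flat p (0 + h) - flat p 0) / h) \<longlongrightarrow> 0) (at_left 0)"
    proof (rule Lim_transform_eventually[OF tendsto_const])
      show "eventually (\<lambda>h. 0 = (flat p (0 + h) - flat p 0) / h) (at_left 0)"
        unfolding eventually_at_filter by (auto simp: flat_def)
    qed
    ultimately have "((\<lambda>h. (flat p (0 + h) - flat p 0) / h) \<longlongrightarrow> 0) (at 0)"
      by (simp add: filterlim_at_split)
    then show ?thesis by (simp add: 2 DERIV_def) (simp add: flat_def)
  next
    case 3
    have d3: "((\<lambda>s. poly p (1 / s) * exp (- (1 / s))) has_real_derivative
        poly (flat_deriv p) (1 / t) * exp (- (1 / t))) (at t)"
      using 3
      by (auto intro!: derivative_eq_intros poly_DERIV[THEN DERIV_chain2]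
          simp: flat_deriv_def divide_simps power2_eq_square) (simp add: algebra_simps)
    have "eventually (\<lambda>s. s \<in> {0<..}) (nhds t)"
      using 3 by (intro eventually_nhds_in_open) auto
    then have ev3: "eventually (\<lambda>s. flat p s = poly p (1 / s) * exp (- (1 / s))) (nhds t)"
      by eventually_elim (simp add: flat_def)
    have "(flat p has_real_derivative poly (flat_deriv p) (1 / t) * exp (- (1 / t))) (at t)"
      using d3 by (simp only: DERIV_cong_ev[OF HOL.refl ev3 HOL.refl])
    moreover have "flat (flat_deriv p) t = poly (flat_deriv p) (1 / t) * exp (- (1 / t))"
      using 3 by (simp only: flat_def if_False not_le[symmetric] simp_thms)
    ultimately show ?thesis by simp
  qed
qed

lemma Ck_on_linear_combination:
  fixes f g :: "real ^ 'n::finite \<Rightarrow> real"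
  assumes "Ck_on k A UNIV f" "Ck_on k A UNIV g"
  shows "Ck_on k A UNIV (\<lambda>x. c * f x + d * g x)"
  using assms
proof (induction k arbitrary: f g)
  case 0
  then show ?case by (auto intro!: continuous_intros)
next
  case (Suc k)
  have fg: "f differentiable (at x)" "g differentiable (at x)" for x
    using Suc.prems by (auto simp: differentiable_on_def)
  have D: "((\<lambda>x. c * f x + d * g x) has_derivative (\<lambda>h. c * (grad f x \<bullet> h) + d * (grad g x \<bullet> h))) (at x)" for x
    by (intro derivative_intros has_derivative_grad fg)
  have "pderiv_dir a (\<lambda>x. c * f x + d * g x) = (\<lambda>x. c * pderiv_dir a f x + d * pderiv_dir a g x)" for a
    by (rule ext) (simp add: has_derivative_pderiv_dir[OF D] inner_axis grad_def)
  moreover have "(\<lambda>x. c * f x + d * g x) differentiable_on UNIV"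
    using D by (auto simp: differentiable_on_def differentiable_def)
  ultimately show ?case using Suc by simp
qed

text \<open>
  A product over the coordinates of functions supported in \<open>[-c, c]\<close>. A partial derivative changes only one
  factor, and gives again a combination of two products of this kind.
\<close>

definition flat_box :: "real \<Rightarrow> ('n::finite \<Rightarrow> real poly) \<Rightarrow> ('n \<Rightarrow> real poly) \<Rightarrow> real ^ 'n \<Rightarrow> real" where
  "flat_box c P Q x = (\<Prod>a\<in>UNIV. flat (P a) (c + x $ a) * flat (Q a) (c - x $ a))"

lemma flat_box_differentiable:
  fixes x :: "real ^ 'n::finite"
  shows "flat_box c P Q differentiable (at x)"
proof -
  have comp: "((\<lambda>x. x $ a) has_derivative (\<lambda>h. h $ a)) (at x)" for a and x :: "real ^ 'n"
    by (rule bounded_linear_imp_has_derivative[OF bounded_linear_vec_nth])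
  have "((\<lambda>x. flat (P a) (c + x $ a)) has_derivative
      (\<lambda>h. (0 + h $ a) * flat (flat_deriv (P a)) (c + x $ a))) (at x)" for a
    by (rule DERIV_compose_FDERIV[OF flat_has_derivative has_derivative_add[OF has_derivative_const comp]])
  moreover have "((\<lambda>x. flat (Q a) (c - x $ a)) has_derivative
      (\<lambda>h. (0 - h $ a) * flat (flat_deriv (Q a)) (c - x $ a))) (at x)" for a
    by (rule DERIV_compose_FDERIV[OF flat_has_derivative has_derivative_diff[OF has_derivative_const comp]])
  ultimately have "\<exists>D. ((\<lambda>x. flat (P a) (c + x $ a) * flat (Q a) (c - x $ a)) has_derivative D) (at x)" for a
    by (intro exI) (rule has_derivative_mult)
  then obtain D where "\<And>a. ((\<lambda>x. flat (P a) (c + x $ a) * flat (Q a) (c - x $ a)) has_derivative D a) (at x)"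
    by metis
  then have "((\<lambda>x. \<Prod>a\<in>UNIV. flat (P a) (c + x $ a) * flat (Q a) (c - x $ a)) has_derivative
      (\<lambda>h. \<Sum>a\<in>UNIV. D a h * (\<Prod>b\<in>UNIV - {a}. flat (P b) (c + x $ b) * flat (Q b) (c - x $ b)))) (at x)"
    by (rule has_derivative_prod)
  then show ?thesis
    unfolding flat_box_def[abs_def] by (rule differentiableI)
qed

lemma pderiv_dir_flat_box:
  "pderiv_dir b (flat_box c P Q) =
    (\<lambda>x. 1 * flat_box c (P(b := flat_deriv (P b))) Q x + (-1) * flat_box c P (Q(b := flat_deriv (Q b))) x)"
proof
  fix x :: "real ^ 'a"
  define C where "C = (\<Prod>a\<in>UNIV - {b}. flat (P a) (c + x $ a) * flat (Q a) (c - x $ a))"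
  have split: "flat_box c P' Q' y = flat (P' b) (c + y $ b) * flat (Q' b) (c - y $ b) * C"
    if "\<And>a. a \<noteq> b \<Longrightarrow> P' a = P a \<and> Q' a = Q a \<and> y $ a = x $ a" for P' Q' and y :: "real ^ 'a"
  proof -
    have "flat_box c P' Q' y = flat (P' b) (c + y $ b) * flat (Q' b) (c - y $ b) *
        (\<Prod>a\<in>UNIV - {b}. flat (P' a) (c + y $ a) * flat (Q' a) (c - y $ a))"
      unfolding flat_box_def by (rule prod.remove) auto
    also have "(\<Prod>a\<in>UNIV - {b}. flat (P' a) (c + y $ a) * flat (Q' a) (c - y $ a)) = C"
      unfolding C_def using that by (intro prod.cong) auto
    finally show ?thesis .
  qed
  have "(\<lambda>t. flat_box c P Q (x + t *\<^sub>R axis b 1)) =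
      (\<lambda>t. flat (P b) (c + x $ b + t) * flat (Q b) (c - x $ b - t) * C)"
    by (rule ext, subst split) (auto simp: axis_def algebra_simps)
  moreover have "((\<lambda>t. flat (P b) (c + x $ b + t) * flat (Q b) (c - x $ b - t) * C) has_real_derivative
      (flat (flat_deriv (P b)) (c + x $ b) * flat (Q b) (c - x $ b) * C
        - flat (P b) (c + x $ b) * flat (flat_deriv (Q b)) (c - x $ b) * C)) (at 0)"
    by (auto intro!: derivative_eq_intros flat_has_derivative[THEN DERIV_chain2] simp: algebra_simps)
  ultimately have "pderiv_dir b (flat_box c P Q) x =
      flat (flat_deriv (P b)) (c + x $ b) * flat (Q b) (c - x $ b) * C
        - flat (P b) (c + x $ b) * flat (flat_deriv (Q b)) (c - x $ b) * C"
    by (simp add: pderiv_dir_def DERIV_imp_deriv)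
  then show "pderiv_dir b (flat_box c P Q) x =
    1 * flat_box c (P(b := flat_deriv (P b))) Q x + (-1) * flat_box c P (Q(b := flat_deriv (Q b))) x"
    by (simp add: split)
qed

lemma Ck_on_flat_box: "Ck_on k UNIV UNIV (flat_box c P Q)"
proof (induction k arbitrary: P Q)
  case 0
  show ?case
    unfolding Ck_on.simps
    by (intro differentiable_imp_continuous_on differentiable_at_imp_differentiable_on
        flat_box_differentiable)
next
  case (Suc k)
  have "Ck_on k UNIV UNIV (pderiv_dir a (flat_box c P Q))" for a
    unfolding pderiv_dir_flat_box by (rule Ck_on_linear_combination[OF Suc Suc])
  then show ?case
    unfolding Ck_on.simps
    by (intro conjI ballI differentiable_at_imp_differentiable_on flat_box_differentiable)
qed

lemma flat_1_nonneg: "0 \<le> flat 1 t" and flat_1_pos: "0 < t \<Longrightarrow> 0 < flat 1 t"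
  and flat_nonpos: "t \<le> 0 \<Longrightarrow> flat p t = 0"
  by (simp_all add: flat_def)

text \<open>
  Existence of a mollifier is needed for \<open>const_K\<close> to be an infimum over a non-empty set. The half side \<open>c\<close>
  is chosen such that the cube lies in the ball of radius \<open>1/2\<close>.
\<close>

lemma mollifier_exists: "\<exists>k :: real ^ 'n::finite \<Rightarrow> real. mollifier k"
proof -
  define N where "N = real CARD('n)"
  have N: "1 \<le> N" using zero_less_card_finite[where 'a = 'n] by (simp add: N_def)
  define c where "c = 1 / (2 * N)"
  have c: "0 < c" using N by (simp add: c_def)
  define g :: "real ^ 'n \<Rightarrow> real" where "g = flat_box c (\<lambda>_. 1) (\<lambda>_. 1)"
  have g0: "0 \<le> g x" for x
    by (auto simp: g_def flat_box_def intro!: prod_nonneg mult_nonneg_nonneg flat_1_nonneg)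
  have supp: "g x = 0" if "x \<notin> cball 0 (1 / 2)" for x
  proof -
    have "\<exists>a. c \<le> \<bar>x $ a\<bar>"
    proof (rule ccontr)
      assume "\<not> ?thesis"
      then have "(\<Sum>a\<in>UNIV. \<bar>x $ a\<bar>) \<le> (\<Sum>a\<in>(UNIV :: 'n set). c)"
        by (intro sum_mono) (auto simp: not_le less_imp_le)
      also have "\<dots> = 1 / 2" using N by (simp add: c_def N_def)
      finally have "norm x \<le> 1 / 2" using norm_le_l1_cart[of x] by linarith
      then show False using that by simp
    qed
    then obtain a where "c \<le> \<bar>x $ a\<bar>" by blast
    then have "c + x $ a \<le> 0 \<or> c - x $ a \<le> 0" by linarith
    then have "flat 1 (c + x $ a) * flat 1 (c - x $ a) = 0" using flat_nonpos by auto
    then show ?thesis unfolding g_def flat_box_def by (intro prod_zero) auto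
  qed
  have bump: "smooth_within (1 / 2) g"
    using supp by (auto simp: smooth_within_def smooth_on_def g_def Ck_on_flat_box)
  have int: "integrable lborel g"
    using smooth_within_integrable_mult[OF bump, of "\<lambda>_. 1" 1] by simp
  define I where "I = (\<integral>x. g x \<partial>lborel)"
  have "0 < g 0" using c by (simp add: g_def flat_box_def flat_1_pos)
  have I: "0 < I"
  proof -
    have "isCont g 0"
      using smooth_within_continuous[OF bump] by (simp add: continuous_on_eq_continuous_at)
    then have "eventually (\<lambda>x. g 0 / 2 < g x) (nhds 0)"
      using \<open>0 < g 0\<close> by (intro order_tendstoD(1)[of g "g 0"]) (auto simp: isCont_def tendsto_at_iff_tendsto_nhds)
    then obtain s where s: "0 < s" "\<And>x. dist x 0 < s \<Longrightarrow> g 0 / 2 < g x"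
      by (auto simp: eventually_nhds_metric)
    have "(\<integral>x. g 0 / 2 * indicator (ball (0 :: real ^ 'n) s) x \<partial>lborel) \<le> I"
      unfolding I_def
    proof (rule Bochner_Integration.integral_mono)
      show "integrable lborel (\<lambda>x. g 0 / 2 * indicator (ball (0 :: real ^ 'n) s) x)"
        using emeasure_lborel_ball_finite[of "0 :: real ^ 'n" s]
        by (intro integrable_mult_right integrable_real_indicator) auto
      show "g 0 / 2 * indicator (ball (0 :: real ^ 'n) s) x \<le> g x" for x
        using s(2)[of x] g0[of x] by (auto simp: indicator_def less_imp_le)
    qed (rule int)
    moreover have "0 < measure lborel (ball (0 :: real ^ 'n) s)" using s(1) by (rule content_ball_pos)
    then have "0 < g 0 / 2 * measure lborel (ball (0 :: real ^ 'n) s)" using \<open>0 < g 0\<close> by simp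
    ultimately show ?thesis by simp
  qed
  \<comment> \<open>Written as a linear combination, so that smoothness follows from that of \<open>g\<close>.\<close>
  define k where "k = (\<lambda>x. 1 / I * g x + 0 * g x)"
  have "mollifier k"
    unfolding mollifier_def
  proof (intro conjI allI)
    show "smooth_on UNIV k"
      unfolding smooth_on_def k_def g_def by (intro allI Ck_on_linear_combination Ck_on_flat_box)
    show "0 \<le> k x" for x using g0 I by (simp add: k_def)
    have "closure {x. k x \<noteq> 0} \<subseteq> cball 0 (1 / 2)"
    proof (rule closure_minimal)
      show "{x. k x \<noteq> 0} \<subseteq> cball 0 (1 / 2)"
      proof (intro subsetI, rule ccontr)
        fix x assume "x \<in> {x. k x \<noteq> 0}" "x \<notin> cball 0 (1 / 2)"
        then show False using supp[of x] by (simp add: k_def)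
      qed
    qed simp
    then show "closure {x. k x \<noteq> 0} \<subseteq> ball 0 1" by auto
    show "integral\<^sup>L lborel k = 1" using I by (simp add: k_def I_def)
  qed
  then show ?thesis by blast
qed

lemma const_K_nonneg: "0 \<le> const_K TYPE('n::finite) m"
  unfolding const_K_def
proof (rule cInf_greatest)
  show "{mollifier_K m k |k :: real ^ 'n \<Rightarrow> real. mollifier k} \<noteq> {}" using mollifier_exists by blast
qed (use mollifier_K_nonneg in blast)

lemma const_K_approx:
  assumes "const_K TYPE('n::finite) m < K"
  obtains k :: "real ^ 'n \<Rightarrow> real" where "mollifier k" "mollifier_K m k \<le> K"
proof -
  have "{mollifier_K m k |k :: real ^ 'n \<Rightarrow> real. mollifier k} \<noteq> {}" using mollifier_exists by blast
  from cInf_lessD[OF this assms[unfolded const_K_def]]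
  obtain k :: "real ^ 'n \<Rightarrow> real" where "mollifier k" "mollifier_K m k < K" by blast
  then show ?thesis using that[of k] by simp
qed

section \<open>Mollified Lipschitz functions as test functions\<close>

text \<open>
  Write \<open>D\<^sup>i = D\<^sub>a D\<^sup>j\<close> with \<open>|j| = |i| - 1\<close>. The derivatives in \<open>D\<^sup>j\<close> are put on the kernel and contribute
  \<open>\<epsilon>^-|j|\<close> and the integral of \<open>|D\<^sup>j k|\<close>, at most \<open>K^|j|\<close>; the remaining function is locally
  Lipschitz because \<open>f\<close> is, and this bounds \<open>D\<^sub>a\<close>. With \<open>\<epsilon> = K / \<beta>\<close> the product is \<open>\<beta>^|j|\<close>.
\<close>

lemma mollify_test_function:
  fixes k :: "real ^ 'n::finite \<Rightarrow> real"
  assumes k: "mollifier k" "mollifier_K m k \<le> K" and "0 < K" "0 < \<beta>" "0 < L"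
    and f: "f \<in> borel_measurable borel" "\<And>x. \<bar>f x\<bar> \<le> M"
    and L: "\<And>x u v. x \<in> \<Omega> \<Longrightarrow> u \<in> ball x (K / \<beta>) \<Longrightarrow> v \<in> ball x (K / \<beta>) \<Longrightarrow> \<bar>f u - f v\<bar> \<le> L * dist u v"
  shows "(\<lambda>x. (1 / L) * mollify k (K / \<beta>) f x) \<in> test_functions \<Omega> m \<beta>"
proof -
  define \<epsilon> where "\<epsilon> = K / \<beta>"
  have \<epsilon>: "0 < \<epsilon>" using assms by (simp add: \<epsilon>_def)
  obtain \<rho> where \<rho>: "0 \<le> \<rho>" "\<rho> < 1" "smooth_within \<rho> k" using mollifier_smooth_within[OF k(1)] .
  define \<phi> where "\<phi> = (\<lambda>x. (1 / L) * mollify k \<epsilon> f x)"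
  have ik: "integrable lborel k"
    using smooth_within_integrable_mult[OF \<rho>(3), of "\<lambda>_. 1" 1] by simp
  have k0: "\<And>z. 0 \<le> k z" and k1: "(\<integral>z. k z \<partial>lborel) = 1" using k(1) by (auto simp: mollifier_def)
  have "\<bar>\<phi> x\<bar> \<le> M / L" for x
  proof -
    have "\<bar>mollify k \<epsilon> f x\<bar> \<le> (\<integral>z. \<bar>k z * f (x - \<epsilon> *\<^sub>R z)\<bar> \<partial>lborel)"
      unfolding mollify_def by (rule integral_abs_bound)
    also have "\<dots> \<le> (\<integral>z. M * k z \<partial>lborel)"
    proof (rule Bochner_Integration.integral_mono)
      fix z
      have "k z * \<bar>f (x - \<epsilon> *\<^sub>R z)\<bar> \<le> k z * M" using k0 f(2) by (intro mult_left_mono)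
      then show "\<bar>k z * f (x - \<epsilon> *\<^sub>R z)\<bar> \<le> M * k z" using k0[of z] by (simp add: abs_mult mult.commute)
    qed (use mollify_integrable[OF \<rho>(3) f] ik in auto)
    also have "\<dots> = M" using k1 by simp
    finally show ?thesis using \<open>0 < L\<close> by (simp add: \<phi>_def divide_right_mono)
  qed
  then have "bounded (\<phi> ` \<Omega>)" by (auto simp: bounded_iff)
  moreover have "smooth_on \<Omega> \<phi>"
    unfolding \<phi>_def by (rule smooth_on_scaled_mollify[OF \<rho>(3) f \<epsilon>])
  moreover have lip: "norm (grad (\<lambda>x. c * mollify g \<epsilon> f x) x) \<le> \<bar>c\<bar> * L * (\<integral>z. \<bar>g z\<bar> \<partial>lborel)"
    if "smooth_within \<rho> g" "x \<in> \<Omega>" for c g x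
  proof (rule locally_lipschitz_grad_le)
    show "(\<lambda>x. c * mollify g \<epsilon> f x) differentiable (at x)"
      by (rule scaled_mollify_has_derivative(1)[OF that(1) f \<epsilon>])
    show "0 < \<epsilon> * (1 - \<rho>)" using \<epsilon> \<rho> by simp
    fix y assume "norm (y - x) < \<epsilon> * (1 - \<rho>)"
    then have "\<bar>c\<bar> * \<bar>mollify g \<epsilon> f y - mollify g \<epsilon> f x\<bar>
        \<le> \<bar>c\<bar> * (L * (\<integral>z. \<bar>g z\<bar> \<partial>lborel) * norm (y - x))"
      using L[OF that(2)] by (intro mult_left_mono mollify_locally_lipschitz[OF that(1) f \<epsilon>])
        (auto simp: \<epsilon>_def)
    then show "\<bar>c * mollify g \<epsilon> f y - c * mollify g \<epsilon> f x\<bar>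
        \<le> \<bar>c\<bar> * L * (\<integral>z. \<bar>g z\<bar> \<partial>lborel) * norm (y - x)"
      by (simp add: right_diff_distrib[symmetric] abs_mult mult.assoc)
  qed
  have "norm (grad \<phi> x) \<le> 1" if "x \<in> \<Omega>" for x
    using lip[OF \<rho>(3) that, of "1 / L"] \<open>0 < L\<close> k0 k1 by (simp add: \<phi>_def)
  moreover have "\<bar>mderiv i \<phi> x\<bar> \<le> \<beta> ^ (mi_order i - 1)"
    if i: "2 \<le> mi_order i" "mi_order i \<le> m" and "x \<in> \<Omega>" for i x
  proof -
    obtain d where d: "mi_order i = Suc d" using i(1) by (cases "mi_order i") auto
    then obtain a j where aj: "\<And>f. mderiv i f = pderiv_dir a (mderiv j f)" "mi_order j = d"
      using mderiv_peel by metis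
    have "mderiv j \<phi> = (\<lambda>x. (1 / L) / \<epsilon> ^ d * mollify (mderiv j k) \<epsilon> f x)"
      unfolding \<phi>_def by (simp only: mderiv_scaled_mollify[OF \<rho>(3) f \<epsilon>] aj(2))
    then have "\<bar>mderiv i \<phi> x\<bar> \<le> norm (grad (\<lambda>x. (1 / L) / \<epsilon> ^ d * mollify (mderiv j k) \<epsilon> f x) x)"
      using component_le_norm_cart[of "grad (mderiv j \<phi>) x" a] by (simp add: aj(1) grad_def)
    also have "\<dots> \<le> \<bar>(1 / L) / \<epsilon> ^ d\<bar> * L * (\<integral>z. \<bar>mderiv j k z\<bar> \<partial>lborel)"
      by (rule lip[OF smooth_within_mderiv[OF \<rho>(3)] \<open>x \<in> \<Omega>\<close>])
    also have "\<dots> \<le> \<bar>(1 / L) / \<epsilon> ^ d\<bar> * L * K ^ d"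
      using integral_mderiv_mollifier_le[OF k, of j] i aj(2) d \<open>0 < L\<close> by (intro mult_left_mono) auto
    also have "\<dots> = \<beta> ^ d"
      using \<open>0 < L\<close> \<open>0 < K\<close> \<open>0 < \<beta>\<close> by (simp add: \<epsilon>_def power_divide)
    finally show ?thesis by (simp add: d)
  qed
  ultimately show ?thesis by (simp add: test_functions_def \<phi>_def \<epsilon>_def)
qed

lemma mollify_close:
  fixes k :: "real ^ 'n::finite \<Rightarrow> real"
  assumes k: "mollifier k" and "0 < \<epsilon>"
    and f: "f \<in> borel_measurable borel" "\<And>x. \<bar>f x\<bar> \<le> M"
    and near: "\<And>u. u \<in> ball x \<epsilon> \<Longrightarrow> \<bar>f u - c\<bar> \<le> B"
  shows "\<bar>mollify k \<epsilon> f x - c\<bar> \<le> B"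
proof -
  obtain \<rho> where \<rho>: "0 \<le> \<rho>" "\<rho> < 1" "smooth_within \<rho> k" using mollifier_smooth_within[OF k(1)] .
  have ik: "integrable lborel k"
    using smooth_within_integrable_mult[OF \<rho>(3), of "\<lambda>_. 1" 1] by simp
  have k0: "\<And>z. 0 \<le> k z" and k1: "(\<integral>z. k z \<partial>lborel) = 1" using k(1) by (auto simp: mollifier_def)
  note int = mollify_integrable[OF \<rho>(3) f, of x \<epsilon>]
  have "mollify k \<epsilon> f x - c = (\<integral>z. k z * f (x - \<epsilon> *\<^sub>R z) - c * k z \<partial>lborel)"
    unfolding mollify_def using int ik k1 by simp
  also have "\<bar>\<dots>\<bar> \<le> (\<integral>z. \<bar>k z * f (x - \<epsilon> *\<^sub>R z) - c * k z\<bar> \<partial>lborel)"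
    by (rule integral_abs_bound)
  also have "\<dots> \<le> (\<integral>z. B * k z \<partial>lborel)"
  proof (rule Bochner_Integration.integral_mono)
    fix z
    show "\<bar>k z * f (x - \<epsilon> *\<^sub>R z) - c * k z\<bar> \<le> B * k z"
    proof (cases "z \<in> cball 0 \<rho>")
      case True
      then have "\<epsilon> * norm z < \<epsilon> * 1" using \<open>0 < \<epsilon>\<close> \<rho>(2) by (intro mult_strict_left_mono) auto
      then have "\<bar>f (x - \<epsilon> *\<^sub>R z) - c\<bar> \<le> B" using \<open>0 < \<epsilon>\<close> by (intro near) (auto simp: dist_norm)
      then have "k z * \<bar>f (x - \<epsilon> *\<^sub>R z) - c\<bar> \<le> k z * B" using k0 by (intro mult_left_mono)
      moreover have "k z * f (x - \<epsilon> *\<^sub>R z) - c * k z = k z * (f (x - \<epsilon> *\<^sub>R z) - c)"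
        by (simp add: algebra_simps)
      ultimately show ?thesis using k0[of z] by (simp add: abs_mult mult.commute)
    next
      case False
      then have "k z = 0" using \<rho>(3) by (auto simp: smooth_within_def)
      then show ?thesis by simp
    qed
  qed (use int ik in auto)
  also have "\<dots> = B" using k1 by simp
  finally show ?thesis .
qed

text \<open>
  Mollify the linear function in the direction of \<open>y - x\<close>, truncated to be bounded. Near \<open>x\<close> and \<open>y\<close> it is
  linear, so averaging does not change the difference of its values there.
\<close>

lemma linear_test_function:
  fixes x y :: "real ^ 'n::finite" and k :: "real ^ 'n \<Rightarrow> real"
  assumes k: "mollifier k" "mollifier_K m k \<le> K" and "0 < K" "0 < \<beta>"
  obtains \<phi> where "\<phi> \<in> test_functions \<Omega> m \<beta>" "\<phi> y - \<phi> x = dist x y"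
proof (cases "x = y")
  case True
  have "(\<lambda>z :: real ^ 'n. (1 / 1) * mollify k (K / \<beta>) (\<lambda>_. 0) z) \<in> test_functions \<Omega> m \<beta>"
    by (rule mollify_test_function[OF assms, where M = 0]) auto
  from that[OF this] show ?thesis using True by simp
next
  case False
  define \<epsilon> where "\<epsilon> = K / \<beta>"
  have \<epsilon>: "0 < \<epsilon>" using assms by (simp add: \<epsilon>_def)
  define u where "u = (1 / dist x y) *\<^sub>R (y - x)"
  have u: "norm u = 1" "u \<bullet> (y - x) = dist x y"
    using False
    by (auto simp: u_def dist_norm norm_minus_commute power2_norm_eq_inner[symmetric] power2_eq_square)
  define R where "R = norm x + norm y + \<epsilon>"
  define f where "f = (\<lambda>z. max (- R) (min R (u \<bullet> z)))"
  have "continuous_on UNIV f" unfolding f_def by (intro continuous_intros)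
  then have fm: "f \<in> borel_measurable borel" by (rule borel_measurable_continuous_onI)
  have R: "0 \<le> R" using \<epsilon> by (simp add: R_def)
  then have fb: "\<bar>f z\<bar> \<le> R" for z by (auto simp: f_def)
  have cs: "\<bar>u \<bullet> w\<bar> \<le> norm w" for w using Cauchy_Schwarz_ineq2[of u w] u(1) by simp
  have fl: "\<bar>f v - f w\<bar> \<le> 1 * dist v w" for v w
  proof -
    have "\<bar>u \<bullet> v - u \<bullet> w\<bar> \<le> dist v w" using cs[of "v - w"] by (simp add: inner_diff_right dist_norm)
    then show ?thesis unfolding f_def by (auto simp: max_def min_def)
  qed
  define \<phi> where "\<phi> = (\<lambda>z. (1 / 1) * mollify k \<epsilon> f z)"
  have 1: "\<phi> \<in> test_functions \<Omega> m \<beta>"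
    unfolding \<phi>_def \<epsilon>_def by (rule mollify_test_function[OF assms _ fm fb fl]) simp
  \<comment> \<open>The increment of \<open>f\<close> by the vector \<open>y - x\<close> is constant near \<open>x\<close>, and so is its average.\<close>
  define h where "h = (\<lambda>w. f (w + (y - x)) - f w)"
  obtain \<rho> where \<rho>: "0 \<le> \<rho>" "\<rho> < 1" "smooth_within \<rho> k" using mollifier_smooth_within[OF k(1)] .
  have hm: "h \<in> borel_measurable borel"
    using fm unfolding h_def by measurable
  have hb: "\<bar>h z\<bar> \<le> 2 * R" for z
    using fb[of z] fb[of "z + (y - x)"] unfolding h_def by linarith
  have fin: "f w = u \<bullet> w" if "norm w \<le> R" for w
    using cs[of w] that by (auto simp: f_def)
  have "mollify k \<epsilon> h x = \<phi> y - \<phi> x"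
  proof -
    have "k z * h (x - \<epsilon> *\<^sub>R z) = k z * f (y - \<epsilon> *\<^sub>R z) - k z * f (x - \<epsilon> *\<^sub>R z)" for z
      by (simp add: h_def algebra_simps)
    then show ?thesis
      using mollify_integrable[OF \<rho>(3) fm fb] by (simp add: mollify_def \<phi>_def)
  qed
  moreover have "\<bar>mollify k \<epsilon> h x - dist x y\<bar> \<le> 0"
  proof (rule mollify_close[OF k(1) \<epsilon> hm hb])
    fix v assume v: "v \<in> ball x \<epsilon>"
    have "norm v \<le> norm x + dist x v" "norm (v + (y - x)) \<le> norm y + dist x v"
      using norm_triangle_sub[of v x] norm_triangle_ineq[of y "v - x"]
      by (auto simp: dist_norm norm_minus_commute algebra_simps)
    then have "norm v \<le> R" "norm (v + (y - x)) \<le> R"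
      using v norm_ge_zero[of x] norm_ge_zero[of y] unfolding R_def mem_ball by linarith+
    then show "\<bar>h v - dist x y\<bar> \<le> 0"
      using u(2) by (simp add: h_def fin inner_add_right)
  qed
  ultimately show ?thesis using that[OF 1] by simp
qed

section \<open>The lower bound\<close>

text \<open>
  The mollification only sees values near \<open>\<Omega>\<close>, so \<open>f\<close> may be cut off outside the \<open>\<epsilon>\<close>-neighbourhood.
\<close>

lemma measurable_locally_lipschitz_extension:
  fixes f :: "'a::euclidean_space \<Rightarrow> real"
  assumes "0 \<le> L" and "\<And>a u v. a \<in> \<Omega> \<Longrightarrow> u \<in> ball a \<epsilon> \<Longrightarrow> v \<in> ball a \<epsilon> \<Longrightarrow> \<bar>f u - f v\<bar> \<le> L * dist u v"
  shows "(\<lambda>z. if z \<in> (\<Union>a\<in>\<Omega>. ball a \<epsilon>) then f z else 0) \<in> borel_measurable borel"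
proof (rule borel_measurable_continuous_on_if)
  have "continuous_on (ball a \<epsilon>) f" if "a \<in> \<Omega>" for a
  proof (rule lipschitz_on_continuous_on)
    show "L-lipschitz_on (ball a \<epsilon>) f"
      using assms that by (intro lipschitz_onI) (auto simp: dist_real_def)
  qed
  then show "continuous_on (\<Union>a\<in>\<Omega>. ball a \<epsilon>) f"
    by (intro continuous_on_open_UN) auto
  show "(\<Union>a\<in>\<Omega>. ball a \<epsilon>) \<in> sets borel" by (intro borel_open open_UN) auto
qed auto

context two_sided_ball
begin

text \<open>
  Points of \<open>closure \<Omega>\<close> at distance less than \<open>2r\<close> can be joined, and \<open>closure \<Omega>\<close> is connected.
\<close>

lemma chain_exists:
  assumes "connected \<Omega>" "x \<in> closure \<Omega>" "y \<in> closure \<Omega>"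
  shows "\<exists>l. polygonal_chain (closure \<Omega>) x y l"
proof (rule connected_equivalence_relation[where S = "closure \<Omega>" and R = "\<lambda>x y. \<exists>l. polygonal_chain (closure \<Omega>) x y l"])
  show "connected (closure \<Omega>)" using assms(1) by (rule connected_imp_connected_closure)
  fix a assume a: "a \<in> closure \<Omega>"
  have "\<exists>l. polygonal_chain (closure \<Omega>) a z l" if "z \<in> closure \<Omega> \<inter> ball a (2 * r)" for z
    using nearby_chain[of "closure \<Omega>" a z 1] that a closure_subset by auto
  then show "\<exists>T. openin (top_of_set (closure \<Omega>)) T \<and> a \<in> T \<and> (\<forall>z\<in>T. \<exists>l. polygonal_chain (closure \<Omega>) a z l)"
    using a r_pos by (intro exI[of _ "closure \<Omega> \<inter> ball a (2 * r)"]) (auto simp: openin_open_Int)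
next
  show "\<exists>l. polygonal_chain (closure \<Omega>) v u l" if "\<exists>l. polygonal_chain (closure \<Omega>) u v l" for u v
    using that polygonal_chain_sym by blast
  show "\<exists>l. polygonal_chain (closure \<Omega>) u w l"
    if "\<exists>l. polygonal_chain (closure \<Omega>) u v l" "\<exists>l. polygonal_chain (closure \<Omega>) v w l" for u v w
    using that polygonal_chain_trans by blast
qed (use assms in auto)

text \<open>
  Segments in a ball of radius \<open>\<epsilon>\<close> about a point of \<open>\<Omega>\<close> lie in the \<open>\<epsilon>\<close>-tube, and their projections can
  be followed by polygons. The truncation by \<open>M\<close> makes the function bounded.
\<close>

lemma tube_extension_lipschitz:
  assumes "connected \<Omega>" "x \<in> closure \<Omega>" "a \<in> \<Omega>" "u \<in> ball a \<epsilon>" "v \<in> ball a \<epsilon>" "\<epsilon> < r"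
  shows "\<bar>min (chain_dist (closure \<Omega>) x (proj u)) M - min (chain_dist (closure \<Omega>) x (proj v)) M\<bar>
    \<le> r / (r - \<epsilon>) * dist u v"
proof -
  have le: "chain_dist (closure \<Omega>) x (proj v) \<le> chain_dist (closure \<Omega>) x (proj u) + r / (r - \<epsilon>) * dist u v"
    if uv: "u \<in> ball a \<epsilon>" "v \<in> ball a \<epsilon>" for u v
  proof (rule field_le_epsilon)
    fix e :: real assume "0 < e"
    have near: "dist z (proj z) \<le> \<epsilon>" if "z \<in> closed_segment u v" for z
    proof -
      have "z \<in> ball a \<epsilon>" using closed_segment_subset[OF uv convex_ball] that by blast
      moreover have "a \<in> closure \<Omega>" using assms(3) closure_subset by blast
      then have "dist z (proj z) \<le> dist z a" by (rule proj_le)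
      ultimately show ?thesis by (simp add: dist_commute)
    qed
    have "polygonal_chain (closure \<Omega>) (proj u) (proj v) (r / (r - \<epsilon>) * dist u v + e)"
      using \<open>0 < e\<close> assms(6)
      by (intro projected_segment_chain near proj_in closure_subset order_refl)
    moreover obtain l where "polygonal_chain (closure \<Omega>) x (proj u) l"
      using chain_exists[OF assms(1,2) proj_in] by blast
    ultimately show "chain_dist (closure \<Omega>) x (proj v)
        \<le> chain_dist (closure \<Omega>) x (proj u) + r / (r - \<epsilon>) * dist u v + e"
      using chain_dist_extend by (simp add: add.assoc)
  qed
  show ?thesis
    using le[OF assms(4,5)] le[OF assms(5,4)] unfolding dist_commute[of v u] by linarith
qed

end

text \<open>
  Averaging over balls of radius \<open>\<epsilon> = K / \<beta>\<close> changes the extended distance function, which has Lipschitz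
  constant \<open>L = 1 / (1 - \<epsilon>/r)\<close>, by at most \<open>L \<epsilon>\<close> at each of \<open>x\<close> and \<open>y\<close>. Dividing by \<open>L\<close> gives the bound.
\<close>

lemma smoothed_distance_lower_bound:
  fixes \<Omega> :: "(real ^ 'n::finite) set" and k :: "real ^ 'n \<Rightarrow> real"
  assumes "two_sided_ball \<Omega> \<nu> r" "connected \<Omega>" "x \<in> \<Omega>" "y \<in> \<Omega>"
    and k: "mollifier k" "mollifier_K m k \<le> K" and "0 < K" "0 < \<beta>" "K / \<beta> < r"
  obtains \<phi> where "\<phi> \<in> test_functions \<Omega> m \<beta>"
    "(1 - K / \<beta> / r) * chain_dist (closure \<Omega>) x y - 2 * (K / \<beta>) \<le> \<phi> y - \<phi> x"
proof -
  interpret two_sided_ball \<Omega> \<nu> r by fact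
  define \<epsilon> where "\<epsilon> = K / \<beta>"
  have \<epsilon>: "0 < \<epsilon>" "\<epsilon> < r" using assms by (auto simp: \<epsilon>_def)
  define L where "L = r / (r - \<epsilon>)"
  have L: "0 < L" using \<epsilon> r_pos by (simp add: L_def)
  define D where "D = chain_dist (closure \<Omega>) x y"
  define F where "F = (\<lambda>z. min (chain_dist (closure \<Omega>) x (proj z)) D)"
  have cl: "x \<in> closure \<Omega>" "y \<in> closure \<Omega>" using assms closure_subset by blast+
  have dist_nonneg: "0 \<le> chain_dist (closure \<Omega>) x p" if "p \<in> closure \<Omega>" for p
    using chain_exists[OF assms(2) cl(1) that] chain_dist_nonneg by metis
  have F_nonneg: "0 \<le> F z" for z
    unfolding F_def D_def by (intro min.boundedI dist_nonneg proj_in cl)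
  have FL: "\<bar>F u - F v\<bar> \<le> L * dist u v" if "a \<in> \<Omega>" "u \<in> ball a \<epsilon>" "v \<in> ball a \<epsilon>" for a u v
    unfolding F_def L_def using that \<epsilon> by (intro tube_extension_lipschitz[OF assms(2) cl(1)])
  define U where "U = (\<Union>a\<in>\<Omega>. ball a \<epsilon>)"
  define f where "f = (\<lambda>z. if z \<in> U then F z else 0)"
  have fm: "f \<in> borel_measurable borel"
    unfolding f_def U_def using L FL by (intro measurable_locally_lipschitz_extension[of L]) auto
  have fb: "\<bar>f z\<bar> \<le> D" for z
    using F_nonneg[of z] F_nonneg[of x] by (auto simp: f_def F_def)
  have fF: "f z = F z" if "a \<in> \<Omega>" "z \<in> ball a \<epsilon>" for a z using that by (auto simp: f_def U_def)
  have fL: "\<bar>f u - f v\<bar> \<le> L * dist u v" if "a \<in> \<Omega>" "u \<in> ball a \<epsilon>" "v \<in> ball a \<epsilon>" for a u v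
    using FL[OF that] fF that by simp
  define \<phi> where "\<phi> = (\<lambda>z. (1 / L) * mollify k \<epsilon> f z)"
  have 1: "\<phi> \<in> test_functions \<Omega> m \<beta>"
    unfolding \<phi>_def \<epsilon>_def by (rule mollify_test_function[OF k \<open>0 < K\<close> \<open>0 < \<beta>\<close> L fm fb]) (rule fL, auto simp: \<epsilon>_def)
  have near: "\<bar>mollify k \<epsilon> f a - f a\<bar> \<le> L * \<epsilon>" if "a \<in> \<Omega>" for a
  proof (rule mollify_close[OF k(1) \<epsilon>(1) fm fb])
    fix v assume v: "v \<in> ball a \<epsilon>"
    have "\<bar>f v - f a\<bar> \<le> L * dist v a" using v \<epsilon> by (intro fL[OF that]) auto
    also have "\<dots> \<le> L * \<epsilon>" using v L by (intro mult_left_mono) (auto simp: dist_commute)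
    finally show "\<bar>f v - f a\<bar> \<le> L * \<epsilon>" .
  qed
  have D0: "0 \<le> D" using F_nonneg[of x] by (simp add: F_def)
  have "f x = 0" "f y = D"
    using \<epsilon> assms(3,4) cl D0
    by (auto simp: fF[of x x] fF[of y y] F_def proj_self chain_dist_self D_def)
  then have "D - 2 * (L * \<epsilon>) \<le> mollify k \<epsilon> f y - mollify k \<epsilon> f x"
    using near[OF assms(3)] near[OF assms(4)] by linarith
  then have "(1 / L) * (D - 2 * (L * \<epsilon>)) \<le> (1 / L) * (mollify k \<epsilon> f y - mollify k \<epsilon> f x)"
    using L by (intro mult_left_mono) auto
  also have "\<dots> = \<phi> y - \<phi> x" by (simp add: \<phi>_def right_diff_distrib)
  also have "(1 / L) * (D - 2 * (L * \<epsilon>)) = (1 / L) * D - 2 * \<epsilon>" using L by (simp add: field_simps)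
  also have "1 / L = 1 - \<epsilon> / r" using \<epsilon> r_pos by (simp add: L_def field_simps)
  finally show ?thesis using that[OF 1] by (simp add: D_def \<epsilon>_def)
qed

text \<open>
  The bound \<open>far\<close> suffices once \<open>2 t r \<le> (1 - t) D\<close>. For smaller \<open>D\<close> the bound \<open>near\<close> is used, so
  \<open>(1 - t) D \<le> s\<close> is to be shown: for large \<open>s\<close> this is immediate, and
  otherwise \<open>arc\<close> reduces it to \<open>(1 - t)\<^sup>2 r\<^sup>2 \<le> r\<^sup>2 - s\<^sup>2/4\<close>.
\<close>

lemma combine_lower_bounds:
  fixes r s t D d :: real
  assumes "0 < r" "0 < t" "t \<le> 3 / 5" "0 \<le> s" "0 \<le> D"
    and far: "(1 - t\<^sup>2) * D - 2 * t\<^sup>2 * r \<le> d" and near: "s \<le> d"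
    and arc: "s < 2 * r \<Longrightarrow> D \<le> r / sqrt (r\<^sup>2 - s\<^sup>2 / 4) * s"
  shows "(1 - t) * D \<le> d"
proof (cases "2 * t * r \<le> (1 - t) * D")
  case True
  then have "t * (2 * t * r) \<le> t * ((1 - t) * D)" using assms(2) by (intro mult_left_mono) auto
  then show ?thesis using far by (simp add: power2_eq_square algebra_simps)
next
  case False
  show ?thesis
  proof (cases "6 / 5 * r \<le> s \<or> D \<le> s")
    case True
    have "(1 - t) * D \<le> 1 * D" using assms by (intro mult_right_mono) auto
    moreover have "t * r \<le> 3 / 5 * r" using assms by (intro mult_right_mono) auto
    ultimately show ?thesis using True False near by linarith
  next
    case c: False
    define q where "q = (1 - t)\<^sup>2"
    have "(1 - t) * s \<le> (1 - t) * D" using c assms by (intro mult_left_mono) auto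
    then have "(1 - t) * s \<le> 2 * t * r" using False by linarith
    then have "((1 - t) * s)\<^sup>2 \<le> (2 * t * r)\<^sup>2" using assms by (intro power_mono) auto
    then have qs: "q * (s\<^sup>2 / 4) \<le> t\<^sup>2 * r\<^sup>2" by (simp add: q_def power_mult_distrib)
    have sr: "s\<^sup>2 \<le> (6 / 5 * r)\<^sup>2" using c assms by (intro power_mono) auto
    \<comment> \<open>For \<open>t \<ge> 1/5\<close> the bound \<open>s \<le> 6r/5\<close> suffices; for smaller \<open>t\<close> the bound \<open>(1 - t) s \<le> 2 t r\<close> is sharper.\<close>
    have "q * r\<^sup>2 \<le> r\<^sup>2 - s\<^sup>2 / 4"
    proof (cases "1 / 5 \<le> t")
      case True
      then have "q \<le> (4 / 5)\<^sup>2" unfolding q_def using assms by (intro power_mono) auto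
      then have "q * r\<^sup>2 \<le> (4 / 5)\<^sup>2 * r\<^sup>2" by (intro mult_right_mono) auto
      then show ?thesis using sr by (simp add: power2_eq_square)
    next
      case False
      have "(4 / 5)\<^sup>2 \<le> q" unfolding q_def using False by (intro power_mono) auto
      then have q: "16 / 25 \<le> q" by (simp add: power2_eq_square)
      have "t * 1 \<le> q * (2 - t)"
      proof -
        have "16 / 25 * (9 / 5) \<le> q * (2 - t)" using q False by (intro mult_mono) auto
        then show ?thesis using False by simp
      qed
      then have "t * (t * 1) \<le> t * (q * (2 - t))" using assms by (intro mult_left_mono) auto
      also have "\<dots> = q * (1 - q)" by (simp add: q_def power2_eq_square algebra_simps)
      finally have "t\<^sup>2 * r\<^sup>2 \<le> q * (1 - q) * r\<^sup>2"
        by (intro mult_right_mono) (auto simp: power2_eq_square)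
      then have "q * (s\<^sup>2 / 4) \<le> q * ((1 - q) * r\<^sup>2)" using qs by (simp add: mult.assoc)
      then have "s\<^sup>2 / 4 \<le> (1 - q) * r\<^sup>2" using q by (simp add: mult_le_cancel_left_pos)
      then show ?thesis by (simp add: algebra_simps)
    qed
    then have "sqrt (q * r\<^sup>2) \<le> sqrt (r\<^sup>2 - s\<^sup>2 / 4)" by (rule real_sqrt_le_mono)
    moreover have "sqrt (q * r\<^sup>2) = (1 - t) * r" using assms by (simp add: q_def real_sqrt_mult)
    ultimately have w: "(1 - t) * r \<le> sqrt (r\<^sup>2 - s\<^sup>2 / 4)" by simp
    have pos: "0 < (1 - t) * r" using assms by simp
    have "s < 2 * r" using c assms by linarith
    then have "D \<le> r / sqrt (r\<^sup>2 - s\<^sup>2 / 4) * s" by (rule arc)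
    also have "\<dots> \<le> r / ((1 - t) * r) * s"
      using w pos less_le_trans[OF pos w] assms(1,3,4)
      by (intro mult_right_mono divide_left_mono mult_pos_pos) simp_all
    also have "\<dots> = s / (1 - t)" using assms by simp
    finally have "(1 - t) * D \<le> s" using assms by (simp add: field_simps)
    then show ?thesis using near by simp
  qed
qed

lemma metric_d_lower_bound:
  fixes \<Omega> :: "(real ^ 'n::finite) set" and k :: "real ^ 'n \<Rightarrow> real"
  assumes tsb: "two_sided_ball \<Omega> \<nu> r" and "connected \<Omega>" "x \<in> \<Omega>" "y \<in> \<Omega>"
    and k: "mollifier k" "mollifier_K m k \<le> K" and "0 < K" "0 < \<beta>" "sqrt (K / (\<beta> * r)) \<le> 3 / 5"
    and bdd: "bdd_above {\<phi> y - \<phi> x | \<phi>. \<phi> \<in> test_functions \<Omega> m \<beta>}"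
  shows "(1 - sqrt (K / (\<beta> * r))) * riem_dist \<Omega> x y \<le> metric_d \<Omega> m \<beta> x y"
proof -
  interpret two_sided_ball \<Omega> \<nu> r by fact
  define t where "t = sqrt (K / (\<beta> * r))"
  have t: "0 < t" "t \<le> 3 / 5" "t\<^sup>2 = K / (\<beta> * r)"
    using assms r_pos by (auto simp: t_def)
  have "t\<^sup>2 \<le> (3 / 5)\<^sup>2" using t by (intro power_mono) auto
  then have t1: "t\<^sup>2 < 1" by (simp add: power2_eq_square)
  have K\<beta>: "K / \<beta> = t\<^sup>2 * r" using t(3) r_pos by simp
  have cl: "x \<in> closure \<Omega>" "y \<in> closure \<Omega>" using assms closure_subset by blast+
  obtain l where l: "polygonal_chain (closure \<Omega>) x y l" using chain_exists[OF assms(2) cl] by blast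
  have up: "\<phi> y - \<phi> x \<le> metric_d \<Omega> m \<beta> x y" if "\<phi> \<in> test_functions \<Omega> m \<beta>" for \<phi>
    unfolding metric_d_def using that by (intro cSup_upper bdd) auto
  have D0: "0 \<le> riem_dist \<Omega> x y"
    unfolding riem_dist_eq
    using polygonal_chain_imp_link[OF l] by (intro cInf_greatest) (auto dest: joined_by_curve_nonneg)
  show ?thesis
    unfolding t_def[symmetric]
  proof (rule combine_lower_bounds[OF r_pos t(1,2) zero_le_dist[of x y] D0])
    have "K / \<beta> < r" using t1 r_pos by (simp add: K\<beta>)
    then obtain \<phi> where \<phi>: "\<phi> \<in> test_functions \<Omega> m \<beta>"
      "(1 - K / \<beta> / r) * chain_dist (closure \<Omega>) x y - 2 * (K / \<beta>) \<le> \<phi> y - \<phi> x"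
      using smoothed_distance_lower_bound[OF tsb assms(2-8)] by metis
    have "(1 - t\<^sup>2) * riem_dist \<Omega> x y \<le> (1 - t\<^sup>2) * chain_dist (closure \<Omega>) x y"
      using t1 riem_dist_le_chain_dist[OF l] by (intro mult_left_mono) auto
    moreover have "K / \<beta> / r = t\<^sup>2" using r_pos by (simp add: K\<beta>)
    ultimately show "(1 - t\<^sup>2) * riem_dist \<Omega> x y - 2 * t\<^sup>2 * r \<le> metric_d \<Omega> m \<beta> x y"
      using \<phi>(2) up[OF \<phi>(1)] by (simp add: K\<beta>)
  next
    obtain \<phi> where \<phi>: "\<phi> \<in> test_functions \<Omega> m \<beta>" "\<phi> y - \<phi> x = dist x y"
      using linear_test_function[OF k \<open>0 < K\<close> \<open>0 < \<beta>\<close>] by metis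
    then show "dist x y \<le> metric_d \<Omega> m \<beta> x y" using up by metis
  next
    assume near: "dist x y < 2 * r"
    show "riem_dist \<Omega> x y \<le> r / sqrt (r\<^sup>2 - (dist x y)\<^sup>2 / 4) * dist x y"
    proof (rule field_le_epsilon)
      fix e :: real assume "0 < e"
      with near show "riem_dist \<Omega> x y \<le> r / sqrt (r\<^sup>2 - (dist x y)\<^sup>2 / 4) * dist x y + e"
        by (intro riem_dist_le_chain nearby_chain closure_subset order_refl cl)
    qed
  qed
qed

section \<open>The comparison theorem\<close>

theorem theorem4p18:
  fixes \<Omega> :: "(real ^ 'n::finite) set" and n :: "real ^ 'n \<Rightarrow> real ^ 'n"
    and r \<beta> K :: real and m :: nat
  assumes "region \<Omega>" and "C2_boundary \<Omega>"
    and "\<And>p. p \<in> frontier \<Omega> \<Longrightarrow> outward_unit_normal \<Omega> p (n p)"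
    and "r > 0"
    and "\<And>p. p \<in> frontier \<Omega> \<Longrightarrow>
           ball (p + r *\<^sub>R n p) r \<inter> frontier \<Omega> = {} \<and> ball (p - r *\<^sub>R n p) r \<inter> frontier \<Omega> = {}"
    and "m \<ge> 1"
    and "K = const_K TYPE('n) m"
    and "\<beta> > 0" and "\<beta> \<ge> 4 * K / r"
  shows "\<forall>x\<in>\<Omega>. \<forall>y\<in>\<Omega>.
           (1 - sqrt (K / (\<beta> * r))) * riem_dist \<Omega> x y \<le> metric_d \<Omega> m \<beta> x y \<and>
           metric_d \<Omega> m \<beta> x y \<le> riem_dist \<Omega> x y"
proof (intro ballI)
  fix x y assume xy: "x \<in> \<Omega>" "y \<in> \<Omega>"
  have \<Omega>: "open \<Omega>" "\<Omega> \<noteq> {}" "connected \<Omega>" using assms(1) by (auto simp: region_def)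
  have tsb: "two_sided_ball \<Omega> n r"
    using \<Omega>(1,2) assms(4,3,5) by (rule two_sided_ballI_normal)
  interpret two_sided_ball \<Omega> n r by (rule tsb)
  have cl: "x \<in> closure \<Omega>" "y \<in> closure \<Omega>" using xy closure_subset by blast+
  obtain l0 where l0: "joined_by_curve (closure \<Omega>) x y l0"
    using chain_exists[OF \<Omega>(3) cl] polygonal_chain_imp_link by metis
  have le_link: "\<phi> y - \<phi> x \<le> l"
    if "\<phi> \<in> test_functions \<Omega> m \<beta>" "joined_by_curve (closure \<Omega>) x y l" for \<phi> l
    using test_function_chain_le[OF \<Omega>(1) that(1)] xy that(2) by (rule chain_lipschitz_le_curve)
  have bdd: "bdd_above {\<phi> y - \<phi> x | \<phi>. \<phi> \<in> test_functions \<Omega> m \<beta>}"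
    using le_link[OF _ l0] by (intro bdd_aboveI[of _ l0]) auto
  have K0: "0 \<le> K" unfolding assms(7) by (rule const_K_nonneg)
  have lower: "(1 - sqrt ((K + e) / (\<beta> * r))) * riem_dist \<Omega> x y \<le> metric_d \<Omega> m \<beta> x y"
    if e: "0 < e" "sqrt ((K + e) / (\<beta> * r)) < 3 / 5" for e
  proof -
    have "const_K TYPE('n) m < K + e" using e assms(7) by simp
    then obtain k :: "real ^ 'n \<Rightarrow> real" where k: "mollifier k" "mollifier_K m k \<le> K + e"
      by (rule const_K_approx)
    show ?thesis
      using K0 e assms(8) by (intro metric_d_lower_bound[OF tsb \<Omega>(3) xy k _ _ _ bdd]) auto
  qed
  have "metric_d \<Omega> m \<beta> x y \<le> riem_dist \<Omega> x y"
    unfolding metric_d_def riem_dist_eq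
  proof (rule cSup_least)
    have "const_K TYPE('n) m < K + 1" using assms(7) by simp
    then obtain k :: "real ^ 'n \<Rightarrow> real" where k: "mollifier k" "mollifier_K m k \<le> K + 1"
      by (rule const_K_approx)
    have "0 < K + 1" using K0 by simp
    from linear_test_function[OF k this assms(8)]
    obtain \<phi> where "\<phi> \<in> test_functions \<Omega> m \<beta>" "\<phi> y - \<phi> x = dist x y" .
    then show "{\<phi> y - \<phi> x | \<phi>. \<phi> \<in> test_functions \<Omega> m \<beta>} \<noteq> {}" by blast
  next
    fix d assume "d \<in> {\<phi> y - \<phi> x | \<phi>. \<phi> \<in> test_functions \<Omega> m \<beta>}"
    then show "d \<le> Inf {l. joined_by_curve (closure \<Omega>) x y l}"
      using le_link l0 by (intro cInf_greatest) auto
  qed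
  moreover have "(1 - sqrt (K / (\<beta> * r))) * riem_dist \<Omega> x y \<le> metric_d \<Omega> m \<beta> x y"
  proof -
    have lim: "((\<lambda>e. sqrt ((K + e) / (\<beta> * r))) \<longlongrightarrow> sqrt ((K + 0) / (\<beta> * r))) (at_right 0)"
      using assms(4,8) by (intro tendsto_intros) auto
    have "K / (\<beta> * r) \<le> (1 / 2)\<^sup>2"
      using assms(4,8,9) by (simp add: field_simps power2_eq_square)
    then have "sqrt (K / (\<beta> * r)) \<le> sqrt ((1 / 2)\<^sup>2)" by (rule real_sqrt_le_mono)
    then have "sqrt ((K + 0) / (\<beta> * r)) < 3 / 5" by simp
    from order_tendstoD(2)[OF lim this] have "eventually (\<lambda>e. sqrt ((K + e) / (\<beta> * r)) < 3 / 5) (at_right 0)" .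
    then have "eventually (\<lambda>e. (1 - sqrt ((K + e) / (\<beta> * r))) * riem_dist \<Omega> x y \<le> metric_d \<Omega> m \<beta> x y) (at_right 0)"
      using eventually_at_right_less by eventually_elim (rule lower)
    moreover have "((\<lambda>e. (1 - sqrt ((K + e) / (\<beta> * r))) * riem_dist \<Omega> x y) \<longlongrightarrow>
        (1 - sqrt ((K + 0) / (\<beta> * r))) * riem_dist \<Omega> x y) (at_right 0)"
      by (intro tendsto_intros lim)
    ultimately have "(1 - sqrt ((K + 0) / (\<beta> * r))) * riem_dist \<Omega> x y \<le> metric_d \<Omega> m \<beta> x y"
      by (intro tendsto_upperbound) auto
    then show ?thesis by simp
  qed
  ultimately show "(1 - sqrt (K / (\<beta> * r))) * riem_dist \<Omega> x y \<le> metric_d \<Omega> m \<beta> x y \<and>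
      metric_d \<Omega> m \<beta> x y \<le> riem_dist \<Omega> x y" by simp
qed

end
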